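(* Let $x_0\in X$ and let $L_n:\Theta_n\to(0,\infty)$, $n\in\mathbb{N}$, be measurable functions such that (A1) for each $n\in\mathbb{N}$ and $\vartheta_n$-a.e. $\theta\in\Theta_n$, $\rho\big(S_\theta^{(n)}(x),S_\theta^{(n)}(y)\big)\le L_n(\theta)\rho(x,y)$ for any $x,y\in X$; (A2) for every $E\in\mathcal{B}((0,\infty))$, $\vartheta_n(L_n^{-1}(E))$ does not depend on $n$, and $R:=\int_{\Theta_1}L_1\,d\vartheta_1<\infty$, $\int_{\Theta_1}\ln L_1\,d\vartheta_1<0$. Suppose that $R<1$ and that $$b:=\sup_{n\in\mathbb{N}}\int_{\Theta_n}\rho\big(S_\theta^{(n)}(x_0),x_0\big)\,\vartheta_n(d\theta)<\infty.$$ Then, whenever $\mu P^{(n)}$ converges weakly to $\pi$ for certain $\mu\in\mathcal{M}_{1,1}(X)$ and $\pi\in\mathcal{M}_1(X)$, one has $\pi\in\mathcal{M}_{1,1}(X)$. In particular, suppose that, in addition, there exist $n_0\in\mathbb{N}$ and measurable functions $M_n:\prod_{k=1}^n\Theta_k\to[0,\infty)$, $n\ge n_0$, such that (A3) for every $n\ge n_0$ and $\bigotimes_{k=1}^n\vartheta_k$-a.e. $(\theta_1,\ldots,\theta_n)$, the maps $S_{\theta_1}^{(1)},\ldots,S_{\theta_n}^{(n)}$ are invertible and $\rho\big(x_0,(\mathcal{S}_{\theta_1,\ldots,\theta_{n-1}}^{-1}\circ S_{\theta_n}^{(n)}\circ\mathcal{S}_{\theta_1,\ldots,\theta_{n-1}})(x_0)\big)\le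 M_n(\theta_1,\ldots,\theta_n)$; (A4) $\sup_{n\ge n_0}\int_{\Theta_1}\ldots\int_{\Theta_n}M_n(\theta_1,\ldots,\theta_n)\,\vartheta_n(d\theta_n)\ldots\vartheta_1(d\theta_1)<\infty$. Then the measure $\pi\in\mathcal{M}_1(X)$ (which exists under (A1)–(A4)) such that, for some $q\in(0,1)$ and $C\in[0,\infty)$, $d_{BL}(\mu P^{(n)},\pi)\le Cq^n(1+\int_X\rho(x,x_0)\,\mu(dx))$ for all $\mu\in\mathcal{M}_{1,1}(X)$ and $n\in\mathbb{N}$, belongs to $\mathcal{M}_{1,1}(X)$.
   Context: Setting. $(X,\rho)$ is a Polish (complete separable) metric space with Borel $\sigma$-field $\mathcal{B}(X)$; $\{(\Theta_n,\mathcal{A}_n,\vartheta_n)\}_{n\in\mathbb{N}}$ is an arbitrary sequence of probability spaces; for each $n\in\mathbb{N}$, $\{S_\theta^{(n)}:\theta\in\Theta_n\}$ is a family of maps from $X$ into itself such that $X\times\Theta_n\ni(x,\theta)\mapsto S_\theta^{(n)}(x)\in X$ is $\mathcal{B}(X)\otimes\mathcal{A}_n/\mathcal{B}(X)$-measurable. For $\theta_k\in\Theta_k$, $\mathcal{S}_{\theta_1,\ldots,\theta_n}:=S_{\theta_n}^{(n)}\circ\cdots\circ S_{\theta_1}^{(1)}$, and $\mathcal{S}_{\theta_1,\ldots,\theta_0}:=\mathrm{id}_X$. Products of the spaces $\Theta_k$ carry product $\sigma$-fields. Measures. $\mathcal{M}_1(X)$ is the set of Borel probability measures on $X$; $\mathcal{M}_{1,1}(X)$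 is the set of $\mu\in\mathcal{M}_1(X)$ with $\int_X\rho(x,z)\,\mu(dx)<\infty$ for some (equivalently all) $z\in X$. $d_{BL}(\mu,\nu):=\sup|\int f\,d\mu-\int f\,d\nu|$, the supremum being over all $f:X\to[-1,1]$ that are Lipschitz with constant at most $1$. Weak convergence means convergence of integrals of all bounded continuous functions. Kernels. $P_n(x,A):=\int_{\Theta_n}\mathbf{1}_A(S_\theta^{(n)}(x))\,\vartheta_n(d\theta)$; $\mu P_n(A):=\int_X P_n(x,A)\,\mu(dx)$; $\mu P^{(n)}:=\mu P_1P_2\cdots P_n$ (apply $P_1$ first, then $P_2$, and so on). *)

theory Defs
  imports "HOL-Probability.Probability"
begin

section \<open>Measures on a Polish metric space\<close>

definition borel_prob :: "'x::polish_space measure set" where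
  "borel_prob = {\<mu>. sets \<mu> = sets borel \<and> prob_space \<mu>}"

definition borel_prob1 :: "'x::polish_space measure set" where
  "borel_prob1 = {\<mu> \<in> borel_prob. \<exists>z. (\<integral>\<^sup>+x. ennreal (dist x z) \<partial>\<mu>) < \<infinity>}"

text \<open>The supremum is taken in the reals; it is bounded by 2 when the arguments are
  probability measures, which is the only case in which it is used.\<close>

definition dist_BL :: "'x::polish_space measure \<Rightarrow> 'x measure \<Rightarrow> real" where
  "dist_BL \<mu> \<nu> =
     (SUP f \<in> {f :: 'x \<Rightarrow> real. (\<forall>x. f x \<in> {-1..1}) \<and> 1-lipschitz_on UNIV f}.
        \<bar>(\<integral>x. f x \<partial>\<mu>) - (\<integral>x. f x \<partial>\<nu>)\<bar>)"

definition weakly_converges :: "(nat \<Rightarrow> 'x::polish_space measure) \<Rightarrow> 'x measure \<Rightarrow> bool" where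
  "weakly_converges \<mu>s \<pi> \<longleftrightarrow>
     (\<forall>f :: 'x \<Rightarrow> real. continuous_on UNIV f \<and> bounded (range f) \<longrightarrow>
        (\<lambda>n. \<integral>x. f x \<partial>\<mu>s n) \<longlonglongrightarrow> (\<integral>x. f x \<partial>\<pi>))"

text \<open>Integral with values in the extended reals, so that an integral equal to \<open>-\<infinity>\<close> is not
  confused with the default value 0 of the Bochner integral. The undefined case
  \<open>\<infinity> - \<infinity>\<close> evaluates to \<open>\<infinity>\<close>.\<close>

definition ext_integral :: "'a measure \<Rightarrow> ('a \<Rightarrow> real) \<Rightarrow> ereal" where
  "ext_integral M f =
     enn2ereal (\<integral>\<^sup>+x. ennreal (f x) \<partial>M) - enn2ereal (\<integral>\<^sup>+x. ennreal (- f x) \<partial>M)"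


section \<open>Random maps and the induced Markov operators\<close>

text \<open>In this section \<open>S n \<theta> x\<close> is the image of \<open>x\<close> under the \<open>n\<close>-th random map with
  parameter \<open>\<theta>\<close>, and \<open>M n\<close> is the law of that parameter. Only indices \<open>n \<ge> 1\<close> are relevant.\<close>

primrec comp_maps :: "(nat \<Rightarrow> 'p \<Rightarrow> 'x \<Rightarrow> 'x) \<Rightarrow> (nat \<Rightarrow> 'p) \<Rightarrow> nat \<Rightarrow> 'x \<Rightarrow> 'x" where
  "comp_maps S \<omega> 0 = id"
| "comp_maps S \<omega> (Suc n) = S (Suc n) (\<omega> (Suc n)) \<circ> comp_maps S \<omega> n"

definition kernel :: "(nat \<Rightarrow> 'p measure) \<Rightarrow> (nat \<Rightarrow> 'p \<Rightarrow> 'x \<Rightarrow> 'x::polish_space)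
    \<Rightarrow> nat \<Rightarrow> 'x \<Rightarrow> 'x measure" where
  "kernel M S n x = distr (M n) borel (\<lambda>\<theta>. S n \<theta> x)"

primrec push :: "(nat \<Rightarrow> 'p measure) \<Rightarrow> (nat \<Rightarrow> 'p \<Rightarrow> 'x \<Rightarrow> 'x::polish_space)
    \<Rightarrow> 'x measure \<Rightarrow> nat \<Rightarrow> 'x measure" where
  "push M S \<mu> 0 = \<mu>"
| "push M S \<mu> (Suc n) = push M S \<mu> n \<bind> kernel M S (Suc n)"

text \<open>The iterated integral
  \<open>\<integral> \<dots> \<integral> f (\<theta>\<^sub>1, \<dots>, \<theta>\<^sub>n) M\<^sub>n(d\<theta>\<^sub>n) \<dots> M\<^sub>1(d\<theta>\<^sub>1)\<close>,
  with the variable of highest index innermost. A tuple is encoded as a function that is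
  \<open>undefined\<close> outside \<open>{1..n}\<close>, as in the product measure \<open>PiM {1..n} M\<close>.\<close>

primrec iterated_integral :: "(nat \<Rightarrow> 'p measure) \<Rightarrow> nat \<Rightarrow> ((nat \<Rightarrow> 'p) \<Rightarrow> ennreal) \<Rightarrow> ennreal" where
  "iterated_integral M 0 f = f (\<lambda>_. undefined)"
| "iterated_integral M (Suc n) f =
     iterated_integral M n (\<lambda>\<omega>. \<integral>\<^sup>+\<theta>. f (fun_upd \<omega> (Suc n) \<theta>) \<partial>M (Suc n))"

text \<open>The Giry monad constructions agree with the explicit formulas for
  \<open>P\<^sub>n(x, A)\<close> and \<open>\<mu>P\<^sub>n(A)\<close>.\<close>

lemma emeasure_kernel:
  fixes S :: "nat \<Rightarrow> 'p \<Rightarrow> 'x::polish_space \<Rightarrow> 'x"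
  assumes S: "(\<lambda>(x, \<theta>). S n \<theta> x) \<in> borel \<Otimes>\<^sub>M M n \<rightarrow>\<^sub>M borel"
    and A: "A \<in> sets borel"
  shows "emeasure (kernel M S n x) A = (\<integral>\<^sup>+\<theta>. indicator A (S n \<theta> x) \<partial>M n)"
proof -
  have [measurable]: "(\<lambda>\<theta>. S n \<theta> x) \<in> M n \<rightarrow>\<^sub>M borel"
    using measurable_compose[OF measurable_Pair1' S, of x] by simp
  have "emeasure (kernel M S n x) A = (\<integral>\<^sup>+y. indicator A y \<partial>kernel M S n x)"
    using A by (simp add: kernel_def)
  also have "\<dots> = (\<integral>\<^sup>+\<theta>. indicator A (S n \<theta> x) \<partial>M n)"
    unfolding kernel_def using A by (subst nn_integral_distr) auto
  finally show ?thesis .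
qed

lemma emeasure_push_Suc:
  fixes S :: "nat \<Rightarrow> 'p \<Rightarrow> 'x::polish_space \<Rightarrow> 'x"
  assumes S: "(\<lambda>(x, \<theta>). S (Suc n) \<theta> x) \<in> borel \<Otimes>\<^sub>M M (Suc n) \<rightarrow>\<^sub>M borel"
    and M: "prob_space (M (Suc n))"
    and \<mu>: "sets (push M S \<mu> n) = sets borel"
    and A: "A \<in> sets borel"
  shows "emeasure (push M S \<mu> (Suc n)) A =
    (\<integral>\<^sup>+x. emeasure (kernel M S (Suc n) x) A \<partial>push M S \<mu> n)"
proof -
  have "M (Suc n) \<in> space (subprob_algebra (M (Suc n)))"
    using M by (simp add: space_subprob_algebra prob_space_imp_subprob_space)
  then have "(\<lambda>x. kernel M S (Suc n) x) \<in> borel \<rightarrow>\<^sub>M subprob_algebra borel"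
    unfolding kernel_def using S by (intro measurable_distr2) auto
  then have "kernel M S (Suc n) \<in> push M S \<mu> n \<rightarrow>\<^sub>M subprob_algebra borel"
    by (simp cong: measurable_cong_sets add: \<mu>)
  moreover have "space (push M S \<mu> n) \<noteq> {}"
    using sets_eq_imp_space_eq[OF \<mu>] by simp
  ultimately show ?thesis
    using A by (simp add: emeasure_bind)
qed

end

theory Submission
  imports Defs
begin

text \<open>For the moment claim, the first moments of \<open>\<mu>P\<^sup>(\<^sup>n\<^sup>)\<close> satisfy
  \<open>m\<^sub>n\<^sub>+\<^sub>1 \<le> R m\<^sub>n + b\<close> and are thus bounded; testing the limit against the bounded Lipschitz
  functions \<open>min k (\<rho>(\<cdot>, x\<^sub>0))\<close> and letting \<open>k\<close> grow transfers the bound to \<open>\<pi>\<close>.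

  For the existence of the limit, let \<open>Z\<^sub>n\<close> be the image of \<open>x\<^sub>0\<close> under the first \<open>n\<close> random maps, on the
  infinite product of the parameter spaces. Invertibility writes \<open>Z\<^sub>n\<^sub>+\<^sub>1\<close> as the image under the first
  \<open>n\<close> maps of a point within distance \<open>M\<^sub>n\<^sub>+\<^sub>1\<close> of \<open>x\<^sub>0\<close>, so
  \<open>\<rho>(Z\<^sub>n, Z\<^sub>n\<^sub>+\<^sub>1) \<le> L\<^sub>1 \<dots> L\<^sub>n M\<^sub>n\<^sub>+\<^sub>1\<close>, and the truncated increments have geometrically decaying expectations.
  Hence \<open>Z\<^sub>n\<close> converges almost surely, and the law of its limit is \<open>\<pi>\<close>; no completeness
  of \<open>d\<^sub>B\<^sub>L\<close> is needed.\<close>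

section \<open>Bounded Lipschitz test functions\<close>

lemma nn_integral_dist_finite_shift:
  fixes \<mu> :: "'x::polish_space measure"
  assumes "\<mu> \<in> borel_prob" "(\<integral>\<^sup>+x. ennreal (dist x z) \<partial>\<mu>) < \<infinity>"
  shows "(\<integral>\<^sup>+x. ennreal (dist x w) \<partial>\<mu>) < \<infinity>"
proof -
  interpret prob_space \<mu> using assms by (simp add: borel_prob_def)
  have [measurable_cong]: "sets \<mu> = sets borel" using assms by (simp add: borel_prob_def)
  have "(\<integral>\<^sup>+x. ennreal (dist x w) \<partial>\<mu>) \<le> (\<integral>\<^sup>+x. ennreal (dist x z) + ennreal (dist z w) \<partial>\<mu>)"
    by (intro nn_integral_mono) (simp add: dist_triangle flip: ennreal_plus)
  also have "\<dots> = (\<integral>\<^sup>+x. ennreal (dist x z) \<partial>\<mu>) + ennreal (dist z w)"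
    by (subst nn_integral_add) (auto simp: emeasure_space_1)
  also have "\<dots> < \<infinity>" using assms(2) by (simp add: less_top)
  finally show ?thesis .
qed

text \<open>The triangle inequality changes the moment by at most the distance of the two base
  points, as the total mass is 1. So the existential base point in the definition may be traded for
  any convenient one, in practice \<open>x0\<close>.\<close>

lemma borel_prob1_iff:
  "\<mu> \<in> borel_prob1 \<longleftrightarrow> \<mu> \<in> borel_prob \<and> (\<integral>\<^sup>+x. ennreal (dist x z) \<partial>\<mu>) < \<infinity>"
  unfolding borel_prob1_def using nn_integral_dist_finite_shift by blast

lemma return_in_borel_prob1: "return borel x \<in> borel_prob1"
  unfolding borel_prob1_def borel_prob_def
  by (auto simp: nn_integral_return intro!: prob_space_return exI[of _ x])

section \<open>The test functions over which \<open>dist_BL\<close> takes its supremum\<close>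

definition lip_unit :: "('x::metric_space \<Rightarrow> real) set" where
  "lip_unit = {f. (\<forall>x. f x \<in> {-1..1}) \<and> 1-lipschitz_on UNIV f}"

lemma lip_unitI:
  assumes "\<And>x. \<bar>f x\<bar> \<le> 1" "\<And>x y. \<bar>f x - f y\<bar> \<le> dist x y"
  shows "f \<in> lip_unit"
proof -
  have "-1 \<le> f x \<and> f x \<le> 1" for x using assms(1)[of x] by linarith
  then show ?thesis using assms(2) by (simp add: lip_unit_def lipschitz_on_def dist_real_def)
qed

lemma lip_unit_abs_le: "f \<in> lip_unit \<Longrightarrow> \<bar>f x\<bar> \<le> 1"
  unfolding lip_unit_def by (auto simp: abs_le_iff dest!: spec[of _ x])

text \<open>Values in [-1,1] give the bound 2, the Lipschitz constant gives the distance. The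
  truncated distance on the right has a finite mean for any pair of random points, so
  \<open>dist_BL\<close> can be estimated without moment assumptions.\<close>

lemma lip_unit_diff_le:
  assumes "f \<in> lip_unit"
  shows "\<bar>f x - f y\<bar> \<le> 2 * min 1 (dist x y)"
proof -
  have "\<bar>f x - f y\<bar> \<le> dist x y"
    using assms lipschitz_onD[of 1 UNIV f x y] by (simp add: lip_unit_def dist_real_def)
  moreover have "\<bar>f x - f y\<bar> \<le> 2"
    using lip_unit_abs_le[OF assms, of x] lip_unit_abs_le[OF assms, of y] by linarith
  ultimately show ?thesis by (auto simp: min_def)
qed

lemma lip_unit_measurable: "f \<in> lip_unit \<Longrightarrow> f \<in> borel_measurable borel"
  by (auto simp: lip_unit_def intro!: borel_measurable_continuous_onI lipschitz_on_continuous_on)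

lemma (in prob_space) lip_unit_integrable:
  assumes "f \<in> lip_unit" "X \<in> M \<rightarrow>\<^sub>M borel"
  shows "integrable M (\<lambda>\<omega>. f (X \<omega>))"
  using assms lip_unit_abs_le[OF assms(1)] lip_unit_measurable[OF assms(1)]
  by (intro integrable_const_bound[where B = 1]) auto

lemma lip_unit_integral_abs_le:
  assumes "f \<in> lip_unit" "\<mu> \<in> borel_prob"
  shows "\<bar>\<integral>x. f x \<partial>\<mu>\<bar> \<le> 1"
proof -
  interpret prob_space \<mu> using assms by (simp add: borel_prob_def)
  have [measurable_cong]: "sets \<mu> = sets borel" using assms by (simp add: borel_prob_def)
  have "integrable \<mu> f"
    using lip_unit_integrable[OF assms(1), of "\<lambda>x. x"] by simp
  moreover have "-1 \<le> f x" "f x \<le> 1" for x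
    using lip_unit_abs_le[OF assms(1), of x] by auto
  ultimately have "-1 \<le> (\<integral>x. f x \<partial>\<mu>)" "(\<integral>x. f x \<partial>\<mu>) \<le> 1"
    by (auto intro!: integral_ge_const integral_le_const)
  then show ?thesis by simp
qed

text \<open>A supremum in the reals dominates its members only if it is bounded; the bound 2 comes
  from both arguments having mass 1.\<close>

lemma dist_BL_upper:
  assumes "f \<in> lip_unit" "\<mu> \<in> borel_prob" "\<nu> \<in> borel_prob"
  shows "\<bar>(\<integral>x. f x \<partial>\<mu>) - (\<integral>x. f x \<partial>\<nu>)\<bar> \<le> dist_BL \<mu> \<nu>"
  unfolding dist_BL_def lip_unit_def[symmetric]
proof (rule cSUP_upper)
  show "bdd_above ((\<lambda>f. \<bar>(\<integral>x. f x \<partial>\<mu>) - (\<integral>x. f x \<partial>\<nu>)\<bar>) ` lip_unit)"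
  proof (rule bdd_aboveI2)
    fix g :: "'a \<Rightarrow> real" assume "g \<in> lip_unit"
    then show "\<bar>(\<integral>x. g x \<partial>\<mu>) - (\<integral>x. g x \<partial>\<nu>)\<bar> \<le> 2"
      using lip_unit_integral_abs_le[of g \<mu>] lip_unit_integral_abs_le[of g \<nu>] assms by linarith
  qed
qed fact

lemma dist_BL_least:
  assumes "\<And>f. f \<in> lip_unit \<Longrightarrow> \<bar>(\<integral>x. f x \<partial>\<mu>) - (\<integral>x. f x \<partial>\<nu>)\<bar> \<le> c"
  shows "dist_BL \<mu> \<nu> \<le> c"
  unfolding dist_BL_def lip_unit_def[symmetric]
proof (rule cSUP_least)
  have "(\<lambda>_. 0) \<in> lip_unit" by (rule lip_unitI) auto
  then show "(lip_unit :: ('a \<Rightarrow> real) set) \<noteq> {}" by blast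
qed fact

text \<open>Every bounded Lipschitz function is a multiple of a test function, so equalities and
  limits of integrals extend from \<open>lip_unit\<close> to all of them. One constant
  \<open>c\<close> serves both as bound and as Lipschitz constant.\<close>

lemma lip_unit_scale:
  fixes g :: "'x::metric_space \<Rightarrow> real"
  assumes "c > 0" "\<And>x. \<bar>g x\<bar> \<le> c" "\<And>x y. \<bar>g x - g y\<bar> \<le> c * dist x y"
  shows "(\<lambda>x. g x / c) \<in> lip_unit"
proof (rule lip_unitI)
  show "\<bar>g x / c\<bar> \<le> 1" for x using assms(1) assms(2)[of x] by simp
  show "\<bar>g x / c - g y / c\<bar> \<le> dist x y" for x y
    using assms(1) assms(3)[of x y] by (simp add: field_simps flip: diff_divide_distrib)
qed

text \<open>Closed sets form an intersection-stable generator of the Borel sets, and the indicator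
  of a nonempty closed set is the pointwise limit of bounded Lipschitz functions of the distance to
  the set. Dominated convergence carries the equality of integrals over to closed sets.\<close>

lemma borel_prob_eqI_lip_unit:
  fixes \<mu> \<nu> :: "'x::polish_space measure"
  assumes \<mu>: "\<mu> \<in> borel_prob" and \<nu>: "\<nu> \<in> borel_prob"
    and eq: "\<And>f. f \<in> lip_unit \<Longrightarrow> (\<integral>x. f x \<partial>\<mu>) = (\<integral>x. f x \<partial>\<nu>)"
  shows "\<mu> = \<nu>"
proof (rule measure_eqI_generator_eq[where E = "Collect closed" and \<Omega> = UNIV and A = "\<lambda>_. UNIV"])
  have "sets (borel :: 'x measure) = sigma_sets UNIV (Collect closed)"
    by (subst borel_eq_closed) simp
  then show "sets \<mu> = sigma_sets UNIV (Collect closed)" "sets \<nu> = sigma_sets UNIV (Collect closed)"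
    using \<mu> \<nu> by (simp_all add: borel_prob_def)
  show "emeasure \<mu> UNIV \<noteq> \<infinity>" for i :: nat
  proof -
    interpret prob_space \<mu> using \<mu> by (simp add: borel_prob_def)
    show ?thesis by simp
  qed
  show "Int_stable (Collect closed :: 'x set set)" by (auto simp: Int_stable_def)
  fix F :: "'x set" assume "F \<in> Collect closed"
  then have F: "closed F" by simp
  show "emeasure \<mu> F = emeasure \<nu> F"
  \<comment> \<open>The empty set is split off because \<open>infdist x {}\<close> is 0 by
    convention: the functions below would then be constantly 1 and not tend to the
    indicator.\<close>
  proof (cases "F = {}")
    case False
    \<comment> \<open>The slope is \<open>Suc k\<close> rather than \<open>k\<close> so that it can
      also serve as the positive divisor in \<open>lip_unit_scale\<close>.\<close>
    define f where "f k x = max 0 (1 - real (Suc k) * infdist x F)" for k x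
    have f_int: "(\<lambda>x. f k x / real (Suc k)) \<in> lip_unit" for k
    proof (rule lip_unit_scale)
      have "0 \<le> real (Suc k) * infdist x F" for x by (simp add: infdist_nonneg)
      then have "\<bar>f k x\<bar> \<le> 1" for x by (simp add: f_def)
      then show "\<bar>f k x\<bar> \<le> real (Suc k)" for x by (rule order_trans) simp
      have "real (Suc k) * \<bar>infdist x F - infdist y F\<bar> \<le> real (Suc k) * dist x y" for x y
        by (intro mult_left_mono infdist_triangle_abs) auto
      then have "\<bar>real (Suc k) * infdist x F - real (Suc k) * infdist y F\<bar> \<le> real (Suc k) * dist x y" for x y
        by (simp add: abs_mult flip: right_diff_distrib)
      then show "\<bar>f k x - f k y\<bar> \<le> real (Suc k) * dist x y" for x y
        unfolding f_def by (smt (verit))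
    qed simp
    have f_eq: "(\<integral>x. f k x \<partial>\<mu>) = (\<integral>x. f k x \<partial>\<nu>)" for k
      using eq[OF f_int[of k]] by simp
    have f_lim: "(\<lambda>k. f k x) \<longlonglongrightarrow> indicator F x" for x
    proof (cases "x \<in> F")
      case True
      then show ?thesis by (simp add: f_def)
    next
      case nF: False
      then have pos: "infdist x F > 0"
        using F False in_closed_iff_infdist_zero[of F x] infdist_nonneg[of x F] by auto
      obtain N where N: "1 < real N * infdist x F" using reals_Archimedean3[OF pos] by blast
      have "f k x = 0" if "k \<ge> N" for k
      proof -
        have "real N * infdist x F \<le> real (Suc k) * infdist x F"
          using that pos by (intro mult_right_mono) auto
        then show ?thesis using N by (simp add: f_def)
      qed
      then have "\<forall>\<^sub>F k in sequentially. f k x = indicator F x"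
        using nF by (auto simp: eventually_sequentially)
      then show ?thesis by (rule tendsto_eventually)
    qed
    have lim: "(\<lambda>k. \<integral>x. f k x \<partial>\<kappa>) \<longlonglongrightarrow> measure \<kappa> F" if "\<kappa> \<in> borel_prob" for \<kappa>
    proof -
      interpret prob_space \<kappa> using that by (simp add: borel_prob_def)
      have [measurable_cong]: "sets \<kappa> = sets borel" using that by (simp add: borel_prob_def)
      have [measurable]: "F \<in> sets borel" using F by simp
      have "f k \<in> borel_measurable borel" for k
        unfolding f_def by (intro borel_measurable_continuous_onI continuous_intros)
      moreover have "\<bar>f k x\<bar> \<le> 1" for k x
        using infdist_nonneg[of x F] by (auto simp: f_def)
      ultimately have "(\<lambda>k. \<integral>x. f k x \<partial>\<kappa>) \<longlonglongrightarrow> (\<integral>x. indicator F x \<partial>\<kappa>)"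
        using f_lim by (intro integral_dominated_convergence[where w = "\<lambda>_. 1"]) auto
      then show ?thesis using F by (simp add: Int_absorb1 sets_eq_imp_space_eq[of \<kappa> borel] \<open>sets \<kappa> = sets borel\<close>)
    qed
    have "measure \<mu> F = measure \<nu> F"
      using lim[OF \<mu>] lim[OF \<nu>] LIMSEQ_unique by (simp add: f_eq)
    then show ?thesis
      using \<mu> \<nu> by (simp add: borel_prob_def prob_space_def finite_measure.emeasure_eq_measure)
  qed simp
qed auto

text \<open>Integrals of truncated distances pass to the limit and keep the bound \<open>B\<close>,
  which does not depend on the truncation level \<open>k\<close>; monotone convergence in
  \<open>k\<close> then bounds the full moment of the limit.\<close>

lemma finite_moment_of_truncated_limit:
  fixes \<pi> :: "'x::polish_space measure"
  assumes \<pi>: "\<pi> \<in> borel_prob" and \<mu>: "\<And>n. \<mu> n \<in> borel_prob"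
    and B: "\<And>n. (\<integral>\<^sup>+x. ennreal (dist x z) \<partial>\<mu> n) \<le> ennreal B"
    and lim: "\<And>k::nat. (\<lambda>n. \<integral>x. min (real k) (dist x z) \<partial>\<mu> n) \<longlonglongrightarrow> (\<integral>x. min (real k) (dist x z) \<partial>\<pi>)"
  shows "\<pi> \<in> borel_prob1"
proof -
  \<comment> \<open>The limits are given for Bochner integrals and the bounds for nonnegative
    integrals; the truncation is bounded, hence integrable, and the two agree.\<close>
  have conv: "(\<integral>\<^sup>+x. ennreal (min (real k) (dist x z)) \<partial>\<kappa>) = ennreal (\<integral>x. min (real k) (dist x z) \<partial>\<kappa>)"
    if "\<kappa> \<in> borel_prob" for \<kappa> and k :: nat
  proof -
    interpret prob_space \<kappa> using that by (simp add: borel_prob_def)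
    have [measurable_cong]: "sets \<kappa> = sets borel" using that by (simp add: borel_prob_def)
    have "integrable \<kappa> (\<lambda>x. min (real k) (dist x z))"
      by (intro integrable_const_bound[where B = "real k"]) auto
    then show ?thesis by (intro nn_integral_eq_integral) auto
  qed
  interpret prob_space \<pi> using \<pi> by (simp add: borel_prob_def)
  have [measurable_cong]: "sets \<pi> = sets borel" using \<pi> by (simp add: borel_prob_def)
  have bound: "(\<integral>\<^sup>+x. ennreal (min (real k) (dist x z)) \<partial>\<pi>) \<le> ennreal B" for k :: nat
  proof -
    have "ennreal (\<integral>x. min (real k) (dist x z) \<partial>\<mu> n) \<le> ennreal B" for n
      unfolding conv[OF \<mu>, symmetric]
      by (rule order_trans[OF nn_integral_mono B[of n]]) (simp add: ennreal_leI)
    then show ?thesis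
      unfolding conv[OF \<pi>] by (intro LIMSEQ_le_const2[OF tendsto_ennrealI[OF lim[of k]]]) auto
  qed
  have "ennreal (dist x z) = (SUP k. ennreal (min (real k) (dist x z)))" for x
  proof (rule antisym)
    obtain k :: nat where "dist x z \<le> real k" using real_arch_simple by blast
    then have "ennreal (dist x z) = ennreal (min (real k) (dist x z))" by simp
    then show "ennreal (dist x z) \<le> (SUP k. ennreal (min (real k) (dist x z)))"
      by (metis SUP_upper UNIV_I)
  qed (auto intro!: SUP_least ennreal_leI)
  then have "(\<integral>\<^sup>+x. ennreal (dist x z) \<partial>\<pi>) = (\<integral>\<^sup>+x. (SUP k. ennreal (min (real k) (dist x z))) \<partial>\<pi>)"
    by simp
  also have "\<dots> = (SUP k. \<integral>\<^sup>+x. ennreal (min (real k) (dist x z)) \<partial>\<pi>)"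
    by (intro nn_integral_monotone_convergence_SUP) (auto simp: incseq_def le_fun_def intro!: ennreal_leI)
  also have "\<dots> \<le> ennreal B" using bound by (intro SUP_least)
  also have "\<dots> < \<infinity>" by simp
  finally show ?thesis
    unfolding borel_prob1_def using \<pi> by blast
qed

text \<open>A coupling bound: with both points on one probability space, the difference of the
  integrals is at most the mean of \<open>\<bar>f (X \<omega>) - f (Y \<omega>)\<bar>\<close>, to
  which \<open>lip_unit_diff_le\<close> applies.\<close>

lemma (in prob_space) lip_unit_integral_diff_le:
  fixes X Y :: "'a \<Rightarrow> 'x::polish_space"
  assumes f: "f \<in> lip_unit" and X[measurable]: "X \<in> M \<rightarrow>\<^sub>M borel" and Y[measurable]: "Y \<in> M \<rightarrow>\<^sub>M borel"
  shows "ennreal \<bar>(\<integral>x. f x \<partial>distr M borel X) - (\<integral>x. f x \<partial>distr M borel Y)\<bar>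
    \<le> 2 * (\<integral>\<^sup>+\<omega>. ennreal (min 1 (dist (X \<omega>) (Y \<omega>))) \<partial>M)"
proof -
  note [measurable] = lip_unit_measurable[OF f]
  have "(\<integral>x. f x \<partial>distr M borel X) - (\<integral>x. f x \<partial>distr M borel Y) = (\<integral>\<omega>. f (X \<omega>) - f (Y \<omega>) \<partial>M)"
    by (simp add: integral_distr lip_unit_integrable[OF f])
  also have "ennreal \<bar>\<dots>\<bar> \<le> (\<integral>\<^sup>+\<omega>. ennreal \<bar>f (X \<omega>) - f (Y \<omega>)\<bar> \<partial>M)"
    using integral_norm_bound_ennreal[of M "\<lambda>\<omega>. f (X \<omega>) - f (Y \<omega>)"]
    by (simp add: lip_unit_integrable[OF f])
  also have "\<dots> \<le> (\<integral>\<^sup>+\<omega>. 2 * ennreal (min 1 (dist (X \<omega>) (Y \<omega>))) \<partial>M)"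
    using lip_unit_diff_le[OF f]
    by (intro nn_integral_mono) (simp add: ennreal_leI flip: ennreal_mult ennreal_numeral)
  also have "\<dots> = 2 * (\<integral>\<^sup>+\<omega>. ennreal (min 1 (dist (X \<omega>) (Y \<omega>))) \<partial>M)"
    by (rule nn_integral_cmult) measurable
  finally show ?thesis .
qed

section \<open>Limits of sequences with summable truncated increments\<close>

lemma convergent_if_truncated_increments_summable:
  fixes z :: "nat \<Rightarrow> 'x::complete_space"
  assumes summable: "summable (\<lambda>n. min 1 (dist (z n) (z (Suc n))))"
  obtains l where "z \<longlonglongrightarrow> l"
    "\<And>n. min 1 (dist (z n) l) \<le> (\<Sum>k. min 1 (dist (z (k + n)) (z (Suc (k + n)))))"
proof -
  define d where "d n = min 1 (dist (z n) (z (Suc n)))" for n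
  define tail where "tail n = (\<Sum>k. d (k + n))" for n
  have d: "summable d" using summable by (simp add: d_def[abs_def])
  have d0: "0 \<le> d n" for n by (simp add: d_def)
  have dtail: "summable (\<lambda>k. d (k + n))" for n using d by (simp add: summable_iff_shift)
  \<comment> \<open>The truncated distance again satisfies the triangle inequality, so the
    increments can be added up before anything is known about their size.\<close>
  have le_sum: "min 1 (dist (z n) (z (n + m))) \<le> (\<Sum>k<m. d (k + n))" for n m
  proof (induction m)
    case (Suc m)
    have "dist (z n) (z (n + Suc m)) \<le> dist (z n) (z (n + m)) + dist (z (n + m)) (z (Suc (n + m)))"
      using dist_triangle[of "z n" "z (Suc (n + m))" "z (n + m)"] by simp
    then have "min 1 (dist (z n) (z (n + Suc m))) \<le> min 1 (dist (z n) (z (n + m))) + d (n + m)"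
      unfolding d_def using zero_le_dist[of "z n" "z (n + m)"] zero_le_dist[of "z (n + m)" "z (Suc (n + m))"]
      by linarith
    with Suc show ?case by (simp add: add.commute)
  qed simp
  have le_tail: "min 1 (dist (z n) (z (n + m))) \<le> tail n" for n m
    unfolding tail_def using le_sum[of n m] sum_le_suminf[OF dtail[of n], of "{..<m}"] d0
    by (auto intro: order_trans)
  have tail0: "tail \<longlonglongrightarrow> 0"
    unfolding LIMSEQ_def
  proof (intro allI impI)
    fix e :: real assume "e > 0"
    from suminf_exist_split[OF this d] obtain N where "\<And>n. n \<ge> N \<Longrightarrow> norm (\<Sum>i. d (i + n)) < e" by auto
    then show "\<exists>no. \<forall>n\<ge>no. dist (tail n) 0 < e" by (auto simp: tail_def)
  qed
  have "Cauchy z"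
  proof (rule metric_CauchyI)
    fix e :: real assume "e > 0"
    \<comment> \<open>Keeping the tail below 1 as well as below \<open>e / 2\<close> makes the
      truncation inactive, so that the bound holds for the distance itself.\<close>
    then obtain N where N: "\<And>n. n \<ge> N \<Longrightarrow> \<bar>tail n\<bar> < min 1 (e / 2)"
      using LIMSEQ_D[OF tail0, of "min 1 (e / 2)"] by auto
    have "dist (z N) (z m) < e / 2" if "m \<ge> N" for m
      using le_tail[of N "m - N"] N[of N] that by auto
    then show "\<exists>M. \<forall>m\<ge>M. \<forall>n\<ge>M. dist (z m) (z n) < e"
      by (metis dist_commute dist_triangle_half_r)
  qed
  then obtain l where l: "z \<longlonglongrightarrow> l" using Cauchy_convergent_iff convergent_def by blast
  \<comment> \<open>The bound \<open>le_tail\<close> is uniform in the later index, which is now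
    sent to infinity with \<open>n\<close> fixed.\<close>
  have "min 1 (dist (z n) l) \<le> tail n" for n
  proof (rule LIMSEQ_le_const2)
    show "(\<lambda>m. min 1 (dist (z n) (z (m + n)))) \<longlonglongrightarrow> min 1 (dist (z n) l)"
      using LIMSEQ_ignore_initial_segment[OF l] by (intro tendsto_intros)
    show "\<exists>N. \<forall>m\<ge>N. min 1 (dist (z n) (z (m + n))) \<le> tail n"
      using le_tail[of n] by (simp add: add.commute)
  qed
  with l show ?thesis using that unfolding tail_def d_def by blast
qed

text \<open>The sum of the truncated increments has finite mean and is therefore almost surely
  finite, which gives almost sure convergence. The rate is the mean of the tail of that sum, a
  geometric series; this is the origin of the factor \<open>1 / (1 - q)\<close>.\<close>

lemma (in prob_space) limit_of_geometric_increments: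
  fixes Z :: "nat \<Rightarrow> 'a \<Rightarrow> 'x::polish_space"
  assumes Z[measurable]: "\<And>n. Z n \<in> M \<rightarrow>\<^sub>M borel"
    and incr: "\<And>n. (\<integral>\<^sup>+\<omega>. ennreal (min 1 (dist (Z n \<omega>) (Z (Suc n) \<omega>))) \<partial>M) \<le> ennreal (A * q ^ n)"
    and q: "0 < q" "q < 1" and A: "0 \<le> A"
  obtains Y where "Y \<in> M \<rightarrow>\<^sub>M borel"
    "\<And>n. (\<integral>\<^sup>+\<omega>. ennreal (min 1 (dist (Z n \<omega>) (Y \<omega>))) \<partial>M) \<le> ennreal (A / (1 - q) * q ^ n)"
proof -
  define d where "d n \<omega> = min 1 (dist (Z n \<omega>) (Z (Suc n) \<omega>))" for n \<omega>
  have [measurable]: "d n \<in> borel_measurable M" for n unfolding d_def by measurable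
  have d0: "0 \<le> d n \<omega>" for n \<omega> by (simp add: d_def)
  have tail: "(\<integral>\<^sup>+\<omega>. (\<Sum>k. ennreal (d (k + n) \<omega>)) \<partial>M) \<le> ennreal (A / (1 - q) * q ^ n)" for n
  proof -
    have "(\<integral>\<^sup>+\<omega>. (\<Sum>k. ennreal (d (k + n) \<omega>)) \<partial>M) = (\<Sum>k. \<integral>\<^sup>+\<omega>. ennreal (d (k + n) \<omega>) \<partial>M)"
      by (rule nn_integral_suminf) measurable
    also have "\<dots> \<le> (\<Sum>k. ennreal (A * q ^ (k + n)))"
      using incr by (intro suminf_le) (auto simp: d_def)
    also have "\<dots> = (\<Sum>k. ennreal (A * q ^ n * q ^ k))"
      by (simp add: power_add mult_ac)
    also have "\<dots> = ennreal (A * q ^ n * (1 / (1 - q)))"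
      using q A by (intro suminf_ennreal_eq sums_mult geometric_sums) auto
    finally show ?thesis by simp
  qed
  have "AE \<omega> in M. (\<Sum>k. ennreal (d k \<omega>)) \<noteq> \<infinity>"
    using tail[of 0] by (intro nn_integral_PInf_AE) (auto simp: top_unique)
  then have summ: "AE \<omega> in M. summable (\<lambda>k. d k \<omega>)"
  proof eventually_elim
    case (elim \<omega>)
    then show ?case using d0 by (intro summable_suminf_not_top) auto
  qed
  \<comment> \<open>Replacing the sequence by a constant where it is not Cauchy makes it converge at
    every point, so that \<open>Y\<close> is measurable as an everywhere limit of measurable
    functions.\<close>
  define Y where "Y \<omega> = lim (\<lambda>n. if Cauchy (\<lambda>n. Z n \<omega>) then Z n \<omega> else undefined)" for \<omega>
  have "Y \<in> M \<rightarrow>\<^sub>M borel"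
  proof (rule borel_measurable_LIMSEQ_metric)
    show "(\<lambda>\<omega>. if Cauchy (\<lambda>n. Z n \<omega>) then Z n \<omega> else undefined) \<in> M \<rightarrow>\<^sub>M borel" for n
      by measurable
    show "(\<lambda>n. if Cauchy (\<lambda>n. Z n \<omega>) then Z n \<omega> else undefined) \<longlonglongrightarrow> Y \<omega>" for \<omega>
      unfolding Y_def by (cases "Cauchy (\<lambda>n. Z n \<omega>)")
        (auto simp: Cauchy_convergent_iff convergent_LIMSEQ_iff intro: tendsto_const)
  qed
  moreover have "(\<integral>\<^sup>+\<omega>. ennreal (min 1 (dist (Z n \<omega>) (Y \<omega>))) \<partial>M) \<le> ennreal (A / (1 - q) * q ^ n)" for n
  proof (rule order_trans[OF nn_integral_mono_AE tail])
    show "AE \<omega> in M. ennreal (min 1 (dist (Z n \<omega>) (Y \<omega>))) \<le> (\<Sum>k. ennreal (d (k + n) \<omega>))"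
      using summ
    proof eventually_elim
      case (elim \<omega>)
      then obtain l where l: "(\<lambda>n. Z n \<omega>) \<longlonglongrightarrow> l"
        and le: "\<And>n. min 1 (dist (Z n \<omega>) l) \<le> (\<Sum>k. d (k + n) \<omega>)"
        unfolding d_def using convergent_if_truncated_increments_summable[of "\<lambda>n. Z n \<omega>"] by metis
      have "Y \<omega> = l"
        using l LIMSEQ_imp_Cauchy[OF l] unfolding Y_def by (simp add: limI)
      moreover have "summable (\<lambda>k. d (k + n) \<omega>)"
        using elim by (simp add: summable_iff_shift[of "\<lambda>k. d k \<omega>"])
      ultimately show ?case
        using le[of n] d0 by (simp add: suminf_ennreal2 ennreal_leI)
    qed
  qed
  ultimately show ?thesis using that by blast
qed

section \<open>Moments as Bochner integrals and under limits along \<open>lip_unit\<close>\<close>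

lemma nn_integral_dist_eq_integral:
  fixes \<mu> :: "'x::polish_space measure"
  assumes "\<mu> \<in> borel_prob1"
  shows "(\<integral>\<^sup>+x. ennreal (dist x z) \<partial>\<mu>) = ennreal (\<integral>x. dist x z \<partial>\<mu>)"
proof -
  have [measurable_cong]: "sets \<mu> = sets borel" and fin: "(\<integral>\<^sup>+x. ennreal (dist x z) \<partial>\<mu>) < \<infinity>"
    using assms borel_prob1_iff[of \<mu> z] by (auto simp: borel_prob_def)
  have "integrable \<mu> (\<lambda>x. dist x z)"
    using fin by (intro integrableI_bounded) auto
  then show ?thesis by (intro nn_integral_eq_integral) auto
qed

text \<open>Truncated distances are multiples of test functions. Convergence against
  \<open>lip_unit\<close> follows both from weak convergence and from convergence in
  \<open>dist_BL\<close>, so this form serves both claims.\<close>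

lemma finite_moment_of_lip_unit_limit:
  fixes \<pi> :: "'x::polish_space measure"
  assumes "\<pi> \<in> borel_prob" "\<And>n. \<mu> n \<in> borel_prob"
    and "\<And>n. (\<integral>\<^sup>+x. ennreal (dist x z) \<partial>\<mu> n) \<le> ennreal B"
    and lim: "\<And>f. f \<in> lip_unit \<Longrightarrow> (\<lambda>n. \<integral>x. f x \<partial>\<mu> n) \<longlonglongrightarrow> (\<integral>x. f x \<partial>\<pi>)"
  shows "\<pi> \<in> borel_prob1"
proof (rule finite_moment_of_truncated_limit[OF assms(1-3)])
  fix k :: nat
  \<comment> \<open>The maximum dominates the bound \<open>k\<close> and the Lipschitz constant 1,
    and it stays positive for \<open>k = 0\<close>.\<close>
  let ?c = "max 1 (real k)"
  have "\<bar>min (real k) (dist x z) - min (real k) (dist y z)\<bar> \<le> ?c * dist x y" for x y :: 'x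
  proof -
    have "\<bar>min (real k) (dist x z) - min (real k) (dist y z)\<bar> \<le> dist x y"
      using dist_triangle[of x z y] dist_triangle[of y z x] by (simp add: dist_commute min_def abs_le_iff)
    also have "\<dots> \<le> ?c * dist x y"
      using mult_right_mono[of 1 ?c "dist x y"] by simp
    finally show ?thesis .
  qed
  then have "(\<lambda>x. min (real k) (dist x z) / ?c) \<in> lip_unit"
    by (intro lip_unit_scale) auto
  from tendsto_mult_left[OF lim[OF this], of ?c]
  show "(\<lambda>n. \<integral>x. min (real k) (dist x z) \<partial>\<mu> n) \<longlonglongrightarrow> (\<integral>x. min (real k) (dist x z) \<partial>\<pi>)"
    by simp
qed

section \<open>Contracting random maps\<close>

declare One_nat_def [simp del]

text \<open>The Lipschitz factors enter through nonnegativity and a common bound \<open>r\<close> <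
  1 on their means; in the application \<open>r\<close> is the number R of (A2). In
  \<open>S_lip\<close> the exceptional set depends on \<open>n\<close> but not on the points
  \<open>x\<close> and \<open>y\<close>.\<close>

locale lipschitz_random_maps =
  fixes \<Theta> :: "nat \<Rightarrow> 'p measure"
    and S :: "nat \<Rightarrow> 'p \<Rightarrow> 'x::polish_space \<Rightarrow> 'x"
    and L :: "nat \<Rightarrow> 'p \<Rightarrow> real"
    and r :: real
  assumes prob: "n \<ge> 1 \<Longrightarrow> prob_space (\<Theta> n)"
    and S_meas: "n \<ge> 1 \<Longrightarrow> (\<lambda>(x, \<theta>). S n \<theta> x) \<in> borel \<Otimes>\<^sub>M \<Theta> n \<rightarrow>\<^sub>M borel"
    and L_meas: "n \<ge> 1 \<Longrightarrow> L n \<in> borel_measurable (\<Theta> n)"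
    and L_nonneg: "n \<ge> 1 \<Longrightarrow> \<theta> \<in> space (\<Theta> n) \<Longrightarrow> 0 \<le> L n \<theta>"
    and S_lip: "n \<ge> 1 \<Longrightarrow> AE \<theta> in \<Theta> n. \<forall>x y. dist (S n \<theta> x) (S n \<theta> y) \<le> L n \<theta> * dist x y"
    and L_mean: "n \<ge> 1 \<Longrightarrow> (\<integral>\<^sup>+\<theta>. ennreal (L n \<theta>) \<partial>\<Theta> n) \<le> ennreal r"
    and r: "0 \<le> r" "r < 1"
begin

section \<open>The infinite product of the parameter spaces\<close>

definition P :: "(nat \<Rightarrow> 'p) measure" where
  "P = PiM {1..} \<Theta>"

lemma prob_space_PiM': "J \<subseteq> {1..} \<Longrightarrow> prob_space (PiM J \<Theta>)"
  using prob by (intro prob_space_PiM) auto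

sublocale param: prob_space P
  unfolding P_def by (rule prob_space_PiM') simp

text \<open>The measure at index 0 is arbitrary, whereas the product locales of the library want
  every factor to be a probability measure.\<close>

definition \<Theta>1 :: "nat \<Rightarrow> 'p measure" where
  "\<Theta>1 n = \<Theta> (max 1 n)"

sublocale prod: product_prob_space \<Theta>1 "{1..}"
proof -
  have "prob_space (\<Theta>1 n)" for n unfolding \<Theta>1_def by (rule prob) simp
  then show "product_prob_space \<Theta>1"
    by (simp add: product_prob_space_def product_sigma_finite_def product_prob_space_axioms_def
        prob_space_imp_sigma_finite)
qed

lemma PiM_\<Theta>1: "J \<subseteq> {1..} \<Longrightarrow> PiM J \<Theta>1 = PiM J \<Theta>"
  by (intro PiM_cong) (auto simp: \<Theta>1_def max_def)

text \<open>Tonelli for the coordinate of highest index, taken from the product with factors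
  \<open>\<Theta>1\<close>, which have the same product over positive indices.\<close>

lemma nn_integral_PiM_Suc:
  assumes "f \<in> borel_measurable (PiM {1..Suc n} \<Theta>)"
  shows "(\<integral>\<^sup>+\<omega>. f \<omega> \<partial>PiM {1..Suc n} \<Theta>) = (\<integral>\<^sup>+\<omega>. \<integral>\<^sup>+\<theta>. f (fun_upd \<omega> (Suc n) \<theta>) \<partial>\<Theta> (Suc n) \<partial>PiM {1..n} \<Theta>)"
proof -
  have "f \<in> borel_measurable (PiM (insert (Suc n) {1..n}) \<Theta>1)"
    using assms by (subst PiM_\<Theta>1) (auto simp: atLeastAtMostSuc_conv)
  then have "(\<integral>\<^sup>+\<omega>. f \<omega> \<partial>PiM (insert (Suc n) {1..n}) \<Theta>1)
      = (\<integral>\<^sup>+\<omega>. \<integral>\<^sup>+\<theta>. f (fun_upd \<omega> (Suc n) \<theta>) \<partial>\<Theta>1 (Suc n) \<partial>PiM {1..n} \<Theta>1)"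
    by (intro prod.product_nn_integral_insert) auto
  then show ?thesis
    by (subst (asm) (1 2) PiM_\<Theta>1) (auto simp: atLeastAtMostSuc_conv \<Theta>1_def)
qed

text \<open>Both sides integrate the highest index innermost, so peeling it off reduces to the
  induction hypothesis for the partially integrated function. This turns (A4) into a bound under the
  product measure.\<close>

lemma iterated_integral_eq_nn_integral:
  assumes "f \<in> borel_measurable (PiM {1..n} \<Theta>)"
  shows "iterated_integral \<Theta> n f = (\<integral>\<^sup>+\<omega>. f \<omega> \<partial>PiM {1..n} \<Theta>)"
  using assms
proof (induction n arbitrary: f)
  case 0
  then show ?case by (simp add: PiM_empty nn_integral_count_space_finite)
next
  case (Suc n)
  interpret prob_space "\<Theta> (Suc n)" by (rule prob) simp
  have "(\<lambda>(\<omega>, \<theta>). fun_upd \<omega> (Suc n) \<theta>) \<in> PiM {1..n} \<Theta> \<Otimes>\<^sub>M \<Theta> (Suc n) \<rightarrow>\<^sub>M PiM {1..Suc n} \<Theta>"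
    using measurable_add_dim[of "Suc n" "{1..n}" \<Theta>] by (simp add: atLeastAtMostSuc_conv)
  from measurable_compose[OF this Suc.prems]
  have "(\<lambda>\<omega>. \<integral>\<^sup>+\<theta>. f (fun_upd \<omega> (Suc n) \<theta>) \<partial>\<Theta> (Suc n)) \<in> borel_measurable (PiM {1..n} \<Theta>)"
    by (intro borel_measurable_nn_integral) (simp add: case_prod_beta' del: fun_upd_apply)
  from Suc.IH[OF this] show ?case
    by (simp add: nn_integral_PiM_Suc[OF Suc.prems] del: fun_upd_apply)
qed

text \<open>Consistency of the marginals: it carries integrals and almost sure statements about the
  first \<open>n\<close> parameters over to \<open>P\<close>.\<close>

lemma distr_P_restrict: "distr P (PiM {1..n} \<Theta>) (\<lambda>\<omega>. restrict \<omega> {1..n}) = PiM {1..n} \<Theta>"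
  using prod.distr_PiM_restrict_finite[of "{1..n}"] by (simp add: PiM_\<Theta>1 P_def)

lemma restrict_measurable: "(\<lambda>\<omega>. restrict \<omega> {1..n}) \<in> P \<rightarrow>\<^sub>M PiM {1..n} \<Theta>"
  unfolding P_def by (rule measurable_restrict_subset) auto

lemma nn_integral_P_restrict:
  "f \<in> borel_measurable (PiM {1..n} \<Theta>) \<Longrightarrow>
    (\<integral>\<^sup>+\<omega>. f (restrict \<omega> {1..n}) \<partial>P) = (\<integral>\<^sup>+\<omega>. f \<omega> \<partial>PiM {1..n} \<Theta>)"
  using nn_integral_distr[OF restrict_measurable, of f n] by (simp add: distr_P_restrict)

lemma AE_P_restrict: "AE \<omega> in PiM {1..n} \<Theta>. Q \<omega> \<Longrightarrow> AE \<omega> in P. Q (restrict \<omega> {1..n})"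
  by (rule AE_distrD[OF restrict_measurable]) (subst distr_P_restrict)

lemma AE_P_component: "n \<ge> 1 \<Longrightarrow> AE \<theta> in \<Theta> n. Q \<theta> \<Longrightarrow> AE \<omega> in P. Q (\<omega> n)"
  unfolding P_def using prob by (intro AE_PiM_component) auto

section \<open>Compositions of the maps and the law described by \<open>push\<close>\<close>

lemma comp_maps_cong:
  "(\<And>k. k \<in> {1..n} \<Longrightarrow> \<omega> k = \<omega>' k) \<Longrightarrow> comp_maps S \<omega> n = comp_maps S \<omega>' n"
  by (induction n) auto

lemma S_measurable:
  assumes "n \<ge> 1" "f \<in> N \<rightarrow>\<^sub>M borel" "g \<in> N \<rightarrow>\<^sub>M \<Theta> n"
  shows "(\<lambda>w. S n (g w) (f w)) \<in> N \<rightarrow>\<^sub>M borel"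
  using measurable_compose[OF measurable_Pair[OF assms(2,3)] S_meas[OF assms(1)]] by simp

text \<open>The index set \<open>I\<close> is left free so that the finite product over
  \<open>{1..n}\<close> and the infinite product \<open>P\<close> are both covered.\<close>

lemma comp_maps_measurable:
  assumes "{1..n} \<subseteq> I"
  shows "(\<lambda>w. comp_maps S (snd w) n (fst w)) \<in> borel \<Otimes>\<^sub>M PiM I \<Theta> \<rightarrow>\<^sub>M borel"
  using assms
proof (induction n)
  case (Suc n)
  then have "Suc n \<in> I" "{1..n} \<subseteq> I" by auto
  then show ?case
    using Suc.IH
    by (auto intro!: S_measurable measurable_compose[OF measurable_snd measurable_component_singleton])
qed simp

lemma comp_maps_measurable':
  assumes "f \<in> N \<rightarrow>\<^sub>M borel" "g \<in> N \<rightarrow>\<^sub>M P"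
  shows "(\<lambda>w. comp_maps S (g w) n (f w)) \<in> N \<rightarrow>\<^sub>M borel"
  using measurable_compose[OF measurable_Pair[OF assms(1) assms(2)[unfolded P_def]] comp_maps_measurable]
  by simp

lemma comp_maps_measurable_fixed: "(\<lambda>\<omega>. comp_maps S \<omega> n x) \<in> PiM {1..n} \<Theta> \<rightarrow>\<^sub>M borel"
  using measurable_compose[OF measurable_Pair[OF measurable_const[of x borel] measurable_ident]
      comp_maps_measurable[OF order_refl], of n] by simp

lemma kernel_measurable: "kernel \<Theta> S (Suc n) \<in> borel \<rightarrow>\<^sub>M subprob_algebra borel"
proof -
  have "\<Theta> (Suc n) \<in> space (subprob_algebra (\<Theta> (Suc n)))"
    using prob[of "Suc n"] by (simp add: space_subprob_algebra prob_space_imp_subprob_space)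
  then show ?thesis
    unfolding kernel_def using S_meas[of "Suc n"] by (intro measurable_distr2) auto
qed

lemma sets_push:
  assumes "sets \<mu> = sets borel"
  shows "sets (push \<Theta> S \<mu> n) = sets borel"
proof (induction n)
  case (Suc n)
  have "space (push \<Theta> S \<mu> n) \<noteq> {}"
    using sets_eq_imp_space_eq[OF Suc] by simp
  then show ?case
    by (simp add: kernel_def)
qed (simp add: assms)

lemma nn_integral_push_Suc:
  assumes \<mu>: "sets \<mu> = sets borel" and f: "f \<in> borel_measurable borel"
  shows "(\<integral>\<^sup>+x. f x \<partial>push \<Theta> S \<mu> (Suc n))
    = (\<integral>\<^sup>+x. \<integral>\<^sup>+\<theta>. f (S (Suc n) \<theta> x) \<partial>\<Theta> (Suc n) \<partial>push \<Theta> S \<mu> n)"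
proof -
  have "kernel \<Theta> S (Suc n) \<in> push \<Theta> S \<mu> n \<rightarrow>\<^sub>M subprob_algebra borel"
    using kernel_measurable by (simp cong: measurable_cong_sets add: sets_push[OF \<mu>])
  then show ?thesis
    using f by (simp add: nn_integral_bind[OF f] kernel_def nn_integral_distr S_measurable)
qed

text \<open>The last operator is moved onto the test function, whose one-step average is again
  Borel; the induction hypothesis, for arbitrary \<open>f\<close>, handles the first
  \<open>n\<close> steps, and Tonelli merges the new parameter into the product.\<close>

lemma nn_integral_push:
  assumes \<mu>: "sets \<mu> = sets borel" and f: "f \<in> borel_measurable borel"
  shows "(\<integral>\<^sup>+x. f x \<partial>push \<Theta> S \<mu> n) = (\<integral>\<^sup>+x. \<integral>\<^sup>+\<omega>. f (comp_maps S \<omega> n x) \<partial>PiM {1..n} \<Theta> \<partial>\<mu>)"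
  using f
proof (induction n arbitrary: f)
  case 0
  interpret prob_space "PiM {} \<Theta>" by (rule prob_space_PiM') simp
  show ?case by (simp add: emeasure_space_1)
next
  case (Suc n)
  note [measurable] = Suc.prems
  interpret prob_space "\<Theta> (Suc n)" by (rule prob) simp
  have "(\<lambda>(x, \<theta>). f (S (Suc n) \<theta> x)) \<in> borel_measurable (borel \<Otimes>\<^sub>M \<Theta> (Suc n))"
    using measurable_compose[OF S_meas[of "Suc n"] Suc.prems] by (simp add: case_prod_beta')
  then have "(\<lambda>x. \<integral>\<^sup>+\<theta>. f (S (Suc n) \<theta> x) \<partial>\<Theta> (Suc n)) \<in> borel_measurable borel"
    by (rule borel_measurable_nn_integral)
  from Suc.IH[OF this]
  have "(\<integral>\<^sup>+x. f x \<partial>push \<Theta> S \<mu> (Suc n)) =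
      (\<integral>\<^sup>+x. \<integral>\<^sup>+\<omega>. \<integral>\<^sup>+\<theta>. f (S (Suc n) \<theta> (comp_maps S \<omega> n x)) \<partial>\<Theta> (Suc n) \<partial>PiM {1..n} \<Theta> \<partial>\<mu>)"
    by (simp only: nn_integral_push_Suc[OF \<mu> Suc.prems])
  also have "\<dots> = (\<integral>\<^sup>+x. \<integral>\<^sup>+\<omega>. f (comp_maps S \<omega> (Suc n) x) \<partial>PiM {1..Suc n} \<Theta> \<partial>\<mu>)"
  proof (rule nn_integral_cong)
    fix x
    have "(\<lambda>\<omega>. comp_maps S \<omega> (Suc n) x) \<in> PiM {1..Suc n} \<Theta> \<rightarrow>\<^sub>M borel"
      by (rule comp_maps_measurable_fixed)
    then have "(\<integral>\<^sup>+\<omega>. f (comp_maps S \<omega> (Suc n) x) \<partial>PiM {1..Suc n} \<Theta>) =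
        (\<integral>\<^sup>+\<omega>. \<integral>\<^sup>+\<theta>. f (comp_maps S (fun_upd \<omega> (Suc n) \<theta>) (Suc n) x) \<partial>\<Theta> (Suc n) \<partial>PiM {1..n} \<Theta>)"
      by (intro nn_integral_PiM_Suc measurable_compose[OF _ Suc.prems])
    moreover have "comp_maps S (fun_upd \<omega> (Suc n) \<theta>) n = comp_maps S \<omega> n" for \<omega> \<theta>
      by (rule comp_maps_cong) auto
    ultimately show "(\<integral>\<^sup>+\<omega>. \<integral>\<^sup>+\<theta>. f (S (Suc n) \<theta> (comp_maps S \<omega> n x)) \<partial>\<Theta> (Suc n) \<partial>PiM {1..n} \<Theta>) =
        (\<integral>\<^sup>+\<omega>. f (comp_maps S \<omega> (Suc n) x) \<partial>PiM {1..Suc n} \<Theta>)"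
      by simp
  qed
  finally show ?case .
qed

lemma comp_maps_restrict: "comp_maps S (restrict \<omega> {1..n}) n = comp_maps S \<omega> n"
  by (rule comp_maps_cong) auto

text \<open>A single space, carrying a start drawn from \<open>\<mu>\<close> and independent
  parameters, represents the measures for all \<open>n\<close> at once. This makes coupling and
  almost sure limits available.\<close>

lemma push_eq_distr:
  assumes \<mu>: "\<mu> \<in> borel_prob"
  shows "push \<Theta> S \<mu> n = distr (\<mu> \<Otimes>\<^sub>M P) borel (\<lambda>(x, \<omega>). comp_maps S \<omega> n x)"
proof (rule measure_eqI)
  have [measurable_cong]: "sets \<mu> = sets borel" using \<mu> by (simp add: borel_prob_def)
  show "sets (push \<Theta> S \<mu> n) = sets (distr (\<mu> \<Otimes>\<^sub>M P) borel (\<lambda>(x, \<omega>). comp_maps S \<omega> n x))"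
    by (simp add: sets_push \<open>sets \<mu> = sets borel\<close>)
  fix A assume "A \<in> sets (push \<Theta> S \<mu> n)"
  then have A[measurable]: "A \<in> sets borel" by (simp add: sets_push \<open>sets \<mu> = sets borel\<close>)
  have meas: "(\<lambda>w. comp_maps S (snd w) n (fst w)) \<in> \<mu> \<Otimes>\<^sub>M P \<rightarrow>\<^sub>M borel"
    by (rule comp_maps_measurable') measurable
  have "emeasure (push \<Theta> S \<mu> n) A = (\<integral>\<^sup>+x. indicator A x \<partial>push \<Theta> S \<mu> n)"
    using A by (simp add: sets_push \<open>sets \<mu> = sets borel\<close>)
  also have "\<dots> = (\<integral>\<^sup>+x. \<integral>\<^sup>+\<omega>. indicator A (comp_maps S \<omega> n x) \<partial>PiM {1..n} \<Theta> \<partial>\<mu>)"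
    by (rule nn_integral_push) (simp_all add: \<open>sets \<mu> = sets borel\<close>)
  also have "\<dots> = (\<integral>\<^sup>+x. \<integral>\<^sup>+\<omega>. indicator A (comp_maps S \<omega> n x) \<partial>P \<partial>\<mu>)"
  proof (rule nn_integral_cong)
    fix x
    have "(\<lambda>\<omega>. comp_maps S \<omega> n x) \<in> PiM {1..n} \<Theta> \<rightarrow>\<^sub>M borel"
      by (rule comp_maps_measurable_fixed)
    then have [measurable]: "(\<lambda>\<omega>. indicator A (comp_maps S \<omega> n x) :: ennreal) \<in> borel_measurable (PiM {1..n} \<Theta>)"
      by (rule measurable_compose) measurable
    show "(\<integral>\<^sup>+\<omega>. indicator A (comp_maps S \<omega> n x) \<partial>PiM {1..n} \<Theta>) = (\<integral>\<^sup>+\<omega>. indicator A (comp_maps S \<omega> n x) \<partial>P)"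
      by (subst nn_integral_P_restrict[symmetric]) (simp_all add: comp_maps_restrict)
  qed
  also have "\<dots> = (\<integral>\<^sup>+w. indicator A (comp_maps S (snd w) n (fst w)) \<partial>(\<mu> \<Otimes>\<^sub>M P))"
    using meas by (subst param.nn_integral_fst[symmetric]) (auto intro: measurable_compose)
  also have "\<dots> = emeasure (distr (\<mu> \<Otimes>\<^sub>M P) borel (\<lambda>(x, \<omega>). comp_maps S \<omega> n x)) A"
    using meas A by (simp add: nn_integral_distr[OF meas, symmetric] case_prod_beta')
  finally show "emeasure (push \<Theta> S \<mu> n) A = emeasure (distr (\<mu> \<Otimes>\<^sub>M P) borel (\<lambda>(x, \<omega>). comp_maps S \<omega> n x)) A" .
qed

lemma push_in_borel_prob:
  assumes "\<mu> \<in> borel_prob"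
  shows "push \<Theta> S \<mu> n \<in> borel_prob"
proof -
  have [measurable_cong]: "sets \<mu> = sets borel" using assms by (simp add: borel_prob_def)
  interpret \<mu>: prob_space \<mu> using assms by (simp add: borel_prob_def)
  interpret pair_prob_space \<mu> P ..
  have "(\<lambda>w. comp_maps S (snd w) n (fst w)) \<in> \<mu> \<Otimes>\<^sub>M P \<rightarrow>\<^sub>M borel"
    by (rule comp_maps_measurable') measurable
  then show ?thesis
    unfolding push_eq_distr[OF assms] borel_prob_def by (simp add: prob_space_distr case_prod_beta')
qed

section \<open>Mean contraction and moment bounds for the composed maps\<close>

lemma AE_comp_maps_lipschitz:
  "AE \<omega> in P. \<forall>n x y. dist (comp_maps S \<omega> n x) (comp_maps S \<omega> n y) \<le> (\<Prod>k\<in>{1..n}. L k (\<omega> k)) * dist x y"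
proof -
  \<comment> \<open>There is one null set per index and the indices are countable, so a single null
    set works for all \<open>n\<close>, \<open>x\<close> and \<open>y\<close>.\<close>
  have "AE \<omega> in P. \<forall>k. k \<ge> 1 \<longrightarrow> (\<forall>x y. dist (S k (\<omega> k) x) (S k (\<omega> k) y) \<le> L k (\<omega> k) * dist x y)"
    using AE_P_component[OF _ S_lip] by (subst AE_all_countable) auto
  then show ?thesis
    using AE_space
  proof eventually_elim
    case (elim \<omega>)
    have "dist (comp_maps S \<omega> n x) (comp_maps S \<omega> n y) \<le> (\<Prod>k\<in>{1..n}. L k (\<omega> k)) * dist x y" for n x y
    proof (induction n)
      case (Suc n)
      \<comment> \<open>Nonnegativity of the factor is known only on the parameter space; it is what
        allows multiplying the induction hypothesis by it.\<close>
      have "\<omega> (Suc n) \<in> space (\<Theta> (Suc n))"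
        using elim(2) by (auto simp: P_def space_PiM)
      then have "0 \<le> L (Suc n) (\<omega> (Suc n))" by (intro L_nonneg) auto
      with Suc have "L (Suc n) (\<omega> (Suc n)) * dist (comp_maps S \<omega> n x) (comp_maps S \<omega> n y)
          \<le> L (Suc n) (\<omega> (Suc n)) * ((\<Prod>k\<in>{1..n}. L k (\<omega> k)) * dist x y)"
        by (intro mult_left_mono)
      moreover have "dist (comp_maps S \<omega> (Suc n) x) (comp_maps S \<omega> (Suc n) y)
          \<le> L (Suc n) (\<omega> (Suc n)) * dist (comp_maps S \<omega> n x) (comp_maps S \<omega> n y)"
        using elim(1) by simp
      ultimately show ?case by (simp add: mult_ac)
    qed simp
    then show ?case by blast
  qed
qed

lemma prod_L_nonneg: "\<omega> \<in> space P \<Longrightarrow> 0 \<le> (\<Prod>k\<in>{1..n}. L k (\<omega> k))"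
  by (intro prod_nonneg ballI L_nonneg) (auto simp: P_def space_PiM)

lemma prod_L_measurable: "(\<lambda>\<omega>. \<Prod>k\<in>{1..n}. L k (\<omega> k)) \<in> borel_measurable P"
  unfolding P_def
  by (intro borel_measurable_prod measurable_compose[OF measurable_component_singleton]) (auto intro: L_meas)

text \<open>Independence: after restriction to the first \<open>n\<close> coordinates the mean of
  the product is the product of the means, each at most \<open>r\<close>.\<close>

lemma nn_integral_prod_L: "(\<integral>\<^sup>+\<omega>. ennreal (\<Prod>k\<in>{1..n}. L k (\<omega> k)) \<partial>P) \<le> ennreal (r ^ n)"
proof -
  have "(\<integral>\<^sup>+\<omega>. ennreal (\<Prod>k\<in>{1..n}. L k (\<omega> k)) \<partial>P) = (\<integral>\<^sup>+\<omega>. (\<Prod>k\<in>{1..n}. ennreal (L k (restrict \<omega> {1..n} k))) \<partial>P)"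
    by (intro nn_integral_cong, subst prod_ennreal[symmetric])
      (auto intro!: L_nonneg prod.cong simp: P_def space_PiM)
  also have "\<dots> = (\<integral>\<^sup>+\<omega>. (\<Prod>k\<in>{1..n}. ennreal (L k (\<omega> k))) \<partial>PiM {1..n} \<Theta>)"
    by (intro nn_integral_P_restrict borel_measurable_prod_ennreal measurable_compose[OF _ measurable_ennreal]
        measurable_compose[OF measurable_component_singleton]) (auto intro: L_meas)
  also have "\<dots> = (\<integral>\<^sup>+\<omega>. (\<Prod>k\<in>{1..n}. ennreal (L k (\<omega> k))) \<partial>PiM {1..n} \<Theta>1)"
    by (subst PiM_\<Theta>1) auto
  also have "\<dots> = (\<Prod>k\<in>{1..n}. \<integral>\<^sup>+\<theta>. ennreal (L k \<theta>) \<partial>\<Theta>1 k)"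
    using L_meas by (intro prod.product_nn_integral_prod) (auto simp: \<Theta>1_def max_def)
  also have "\<dots> \<le> (\<Prod>k\<in>{1..n}. ennreal r)"
    using L_mean by (intro prod_mono_ennreal) (auto simp: \<Theta>1_def max_def)
  also have "\<dots> = ennreal (r ^ n)" using r by (simp add: ennreal_power)
  finally show ?thesis .
qed

text \<open>Two starting points are driven by the same parameters, so their distance shrinks by the
  product of the Lipschitz factors.\<close>

lemma nn_integral_dist_comp_maps:
  "(\<integral>\<^sup>+\<omega>. ennreal (dist (comp_maps S \<omega> n x) (comp_maps S \<omega> n y)) \<partial>P) \<le> ennreal (r ^ n * dist x y)"
proof -
  have "(\<integral>\<^sup>+\<omega>. ennreal (dist (comp_maps S \<omega> n x) (comp_maps S \<omega> n y)) \<partial>P)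
      \<le> (\<integral>\<^sup>+\<omega>. ennreal (\<Prod>k\<in>{1..n}. L k (\<omega> k)) * ennreal (dist x y) \<partial>P)"
  proof (rule nn_integral_mono_AE)
    show "AE \<omega> in P. ennreal (dist (comp_maps S \<omega> n x) (comp_maps S \<omega> n y))
        \<le> ennreal (\<Prod>k\<in>{1..n}. L k (\<omega> k)) * ennreal (dist x y)"
      using AE_comp_maps_lipschitz AE_space
    proof eventually_elim
      case (elim \<omega>)
      then show ?case
        using prod_L_nonneg[OF elim(2), of n] by (simp add: ennreal_leI flip: ennreal_mult)
    qed
  qed
  also have "\<dots> = (\<integral>\<^sup>+\<omega>. ennreal (\<Prod>k\<in>{1..n}. L k (\<omega> k)) \<partial>P) * ennreal (dist x y)"
    using prod_L_measurable by (intro nn_integral_multc) simp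
  also have "\<dots> \<le> ennreal (r ^ n) * ennreal (dist x y)"
    by (intro mult_right_mono nn_integral_prod_L) simp
  finally show ?thesis using r by (simp add: ennreal_mult)
qed

text \<open>Comparing with the image of \<open>x0\<close> gives the recursion
  \<open>m' \<le> r * m + b\<close> for successive moments. Its fixed point is
  \<open>b / (1 - r)\<close>, so adding the initial bound \<open>V\<close> gives a level that one
  step does not exceed.\<close>

lemma nn_integral_dist_push:
  assumes \<mu>: "\<mu> \<in> borel_prob" and V: "(\<integral>\<^sup>+x. ennreal (dist x x0) \<partial>\<mu>) \<le> ennreal V" "0 \<le> V"
    and b: "\<And>n. n \<ge> 1 \<Longrightarrow> (\<integral>\<^sup>+\<theta>. ennreal (dist (S n \<theta> x0) x0) \<partial>\<Theta> n) \<le> ennreal b" "0 \<le> b"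
  shows "(\<integral>\<^sup>+x. ennreal (dist x x0) \<partial>push \<Theta> S \<mu> n) \<le> ennreal (V + b / (1 - r))"
proof (induction n)
  case 0
  show ?case using V(1) r b(2) by (auto intro!: order_trans[OF V(1)] ennreal_leI)
next
  case (Suc n)
  have sets: "sets \<mu> = sets borel" using \<mu> by (simp add: borel_prob_def)
  interpret T: prob_space "\<Theta> (Suc n)" by (rule prob) simp
  interpret M: prob_space "push \<Theta> S \<mu> n" using push_in_borel_prob[OF \<mu>] by (simp add: borel_prob_def)
  have [measurable_cong]: "sets (push \<Theta> S \<mu> n) = sets borel" by (rule sets_push[OF sets])
  note [measurable] = L_meas[of "Suc n", simplified]
  have [measurable]: "(\<lambda>\<theta>. S (Suc n) \<theta> x0) \<in> \<Theta> (Suc n) \<rightarrow>\<^sub>M borel"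
    by (rule S_measurable) auto
  have step: "(\<integral>\<^sup>+\<theta>. ennreal (dist (S (Suc n) \<theta> x) x0) \<partial>\<Theta> (Suc n)) \<le> ennreal r * ennreal (dist x x0) + ennreal b" for x
  proof -
    have "(\<integral>\<^sup>+\<theta>. ennreal (dist (S (Suc n) \<theta> x) x0) \<partial>\<Theta> (Suc n)) \<le>
        (\<integral>\<^sup>+\<theta>. ennreal (L (Suc n) \<theta>) * ennreal (dist x x0) + ennreal (dist (S (Suc n) \<theta> x0) x0) \<partial>\<Theta> (Suc n))"
    proof (rule nn_integral_mono_AE)
      show "AE \<theta> in \<Theta> (Suc n). ennreal (dist (S (Suc n) \<theta> x) x0)
          \<le> ennreal (L (Suc n) \<theta>) * ennreal (dist x x0) + ennreal (dist (S (Suc n) \<theta> x0) x0)"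
        using S_lip[of "Suc n", simplified] AE_space
      proof eventually_elim
        case (elim \<theta>)
        have "dist (S (Suc n) \<theta> x) x0 \<le> L (Suc n) \<theta> * dist x x0 + dist (S (Suc n) \<theta> x0) x0"
          using elim(1) dist_triangle[of "S (Suc n) \<theta> x" x0 "S (Suc n) \<theta> x0"] by (smt (verit))
        then show ?case
          using L_nonneg[OF _ elim(2)] by (simp add: ennreal_leI flip: ennreal_mult ennreal_plus)
      qed
    qed
    also have "\<dots> = (\<integral>\<^sup>+\<theta>. ennreal (L (Suc n) \<theta>) \<partial>\<Theta> (Suc n)) * ennreal (dist x x0)
        + (\<integral>\<^sup>+\<theta>. ennreal (dist (S (Suc n) \<theta> x0) x0) \<partial>\<Theta> (Suc n))"
      by (subst nn_integral_add) (auto simp: nn_integral_multc)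
    also have "\<dots> \<le> ennreal r * ennreal (dist x x0) + ennreal b"
      using L_mean[of "Suc n"] b(1)[of "Suc n"] by (intro add_mono mult_right_mono) auto
    finally show ?thesis .
  qed
  have "(\<integral>\<^sup>+x. ennreal (dist x x0) \<partial>push \<Theta> S \<mu> (Suc n))
      \<le> (\<integral>\<^sup>+x. ennreal r * ennreal (dist x x0) + ennreal b \<partial>push \<Theta> S \<mu> n)"
    by (subst nn_integral_push_Suc[OF sets]) (auto intro!: nn_integral_mono step)
  also have "\<dots> = ennreal r * (\<integral>\<^sup>+x. ennreal (dist x x0) \<partial>push \<Theta> S \<mu> n) + ennreal b"
    by (subst nn_integral_add) (auto simp: nn_integral_cmult M.emeasure_space_1)
  also have "\<dots> \<le> ennreal r * ennreal (V + b / (1 - r)) + ennreal b"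
    by (intro add_mono mult_left_mono Suc.IH) auto
  also have "\<dots> = ennreal (r * (V + b / (1 - r)) + b)"
    using r V b by (simp add: ennreal_mult ennreal_plus)
  also have "r * (V + b / (1 - r)) + b = r * V + b / (1 - r)"
    using r by (simp add: field_simps)
  also have "\<dots> \<le> V + b / (1 - r)"
    using r V(2) by (simp add: mult_left_le_one_le)
  finally show ?case by (simp add: ennreal_leI)
qed

text \<open>The product of the Lipschitz constants and \<open>K\<close> are not independent; splitting their
  product by \<open>min 1 (u v) \<le> u + v\<close> separates them at the price of the square root of \<open>r\<close>.\<close>

lemma nn_integral_increment:
  assumes K: "K \<in> borel_measurable (PiM {1..Suc n} \<Theta>)" "\<And>\<omega>. \<omega> \<in> space (PiM {1..Suc n} \<Theta>) \<Longrightarrow> 0 \<le> K \<omega>"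
    and K_bound: "AE \<omega> in PiM {1..Suc n} \<Theta>. (\<forall>k\<in>{1..Suc n}. bij (S k (\<omega> k))) \<and>
      dist x0 ((inv (comp_maps S \<omega> n) \<circ> S (Suc n) (\<omega> (Suc n)) \<circ> comp_maps S \<omega> n) x0) \<le> K \<omega>"
    and K_mean: "(\<integral>\<^sup>+\<omega>. ennreal (K \<omega>) \<partial>PiM {1..Suc n} \<Theta>) \<le> ennreal c" "0 \<le> c"
    and q: "0 < q" "r \<le> q\<^sup>2"
  shows "(\<integral>\<^sup>+\<omega>. ennreal (min 1 (dist (comp_maps S \<omega> n x0) (comp_maps S \<omega> (Suc n) x0))) \<partial>P)
    \<le> ennreal ((1 + c) * q ^ n)"
proof -
  let ?L = "\<lambda>\<omega>. \<Prod>k\<in>{1..n}. L k (\<omega> k)" and ?K = "\<lambda>\<omega>. K (restrict \<omega> {1..Suc n})"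
  have K_meas: "(\<lambda>\<omega>. ennreal (?K \<omega>)) \<in> borel_measurable P"
    using measurable_compose[OF restrict_measurable K(1)] by measurable
  have "AE \<omega> in P. ennreal (min 1 (dist (comp_maps S \<omega> n x0) (comp_maps S \<omega> (Suc n) x0)))
      \<le> ennreal (1 / q ^ n) * ennreal (?L \<omega>) + ennreal (q ^ n) * ennreal (?K \<omega>)"
    using AE_P_restrict[OF K_bound] AE_comp_maps_lipschitz AE_space
  proof eventually_elim
    case (elim \<omega>)
    have restr: "comp_maps S (restrict \<omega> {1..Suc n}) n = comp_maps S \<omega> n"
      by (rule comp_maps_cong) auto
    \<comment> \<open>Surjectivity of the first \<open>n\<close> maps makes the next orbit point
      their image of \<open>y\<close>. The increment thus becomes the distance of the images of
      \<open>x0\<close> and \<open>y\<close> under the same composition, and \<open>K\<close> bounds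
      the distance of \<open>x0\<close> to \<open>y\<close>.\<close>
    define y where "y = inv (comp_maps S \<omega> n) (S (Suc n) (\<omega> (Suc n)) (comp_maps S \<omega> n x0))"
    have bij: "bij (S k (\<omega> k))" if "k \<in> {1..n}" for k
      using elim(1) that by auto
    have "bij (comp_maps S \<omega> m)" if "m \<le> n" for m
      using that by (induction m) (auto intro!: bij_comp bij)
    then have "surj (comp_maps S \<omega> n)" by (simp add: bij_is_surj)
    then have y: "comp_maps S \<omega> (Suc n) x0 = comp_maps S \<omega> n y"
      unfolding y_def by (simp add: surj_f_inv_f)
    have L0: "0 \<le> ?L \<omega>" by (rule prod_L_nonneg[OF elim(3)])
    have K0: "0 \<le> ?K \<omega>"
      using elim(3) by (intro K(2) measurable_space[OF restrict_measurable])
    have "dist (comp_maps S \<omega> n x0) (comp_maps S \<omega> (Suc n) x0) \<le> ?L \<omega> * dist x0 y"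
      unfolding y using elim(2) by blast
    also have "dist x0 y \<le> ?K \<omega>"
      using elim(1) unfolding restr y_def by auto
    finally have "dist (comp_maps S \<omega> n x0) (comp_maps S \<omega> (Suc n) x0) \<le> ?L \<omega> * ?K \<omega>"
      using L0 by (simp add: mult_left_mono)
    \<comment> \<open>The weights cancel in the product but balance the means: the first factor has
      mean at most \<open>(r / q) ^ n\<close>, the second at most \<open>c * q ^ n\<close>.\<close>
    also have "?L \<omega> * ?K \<omega> = (1 / q ^ n * ?L \<omega>) * (q ^ n * ?K \<omega>)"
      using q by simp
    finally have dist_le: "dist (comp_maps S \<omega> n x0) (comp_maps S \<omega> (Suc n) x0)
        \<le> (1 / q ^ n * ?L \<omega>) * (q ^ n * ?K \<omega>)" .
    \<comment> \<open>If \<open>u\<close> is at most 1 the product is at most \<open>v\<close>;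
      otherwise 1 is below \<open>u\<close>.\<close>
    have "min 1 (u * v) \<le> u + v" if "0 \<le> u" "0 \<le> v" for u v :: real
      using that mult_right_mono[of u 1 v] by (cases "u \<le> 1") (auto simp: min_def)
    from this[of "1 / q ^ n * ?L \<omega>" "q ^ n * ?K \<omega>"] dist_le
    have "min 1 (dist (comp_maps S \<omega> n x0) (comp_maps S \<omega> (Suc n) x0))
        \<le> 1 / q ^ n * ?L \<omega> + q ^ n * ?K \<omega>"
      using L0 K0 q by (auto simp: min_def split: if_splits)
    then show ?case
      using L0 K0 q by (simp add: ennreal_leI flip: ennreal_mult ennreal_plus)
  qed
  then have "(\<integral>\<^sup>+\<omega>. ennreal (min 1 (dist (comp_maps S \<omega> n x0) (comp_maps S \<omega> (Suc n) x0))) \<partial>P)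
      \<le> (\<integral>\<^sup>+\<omega>. ennreal (1 / q ^ n) * ennreal (?L \<omega>) + ennreal (q ^ n) * ennreal (?K \<omega>) \<partial>P)"
    by (rule nn_integral_mono_AE)
  also have "\<dots> = ennreal (1 / q ^ n) * (\<integral>\<^sup>+\<omega>. ennreal (?L \<omega>) \<partial>P) + ennreal (q ^ n) * (\<integral>\<^sup>+\<omega>. ennreal (?K \<omega>) \<partial>P)"
    using prod_L_measurable[of n] K_meas by (subst nn_integral_add) (auto simp: nn_integral_cmult)
  also have "(\<integral>\<^sup>+\<omega>. ennreal (?K \<omega>) \<partial>P) = (\<integral>\<^sup>+\<omega>. ennreal (K \<omega>) \<partial>PiM {1..Suc n} \<Theta>)"
    using K(1) by (intro nn_integral_P_restrict) measurable
  also have "ennreal (1 / q ^ n) * (\<integral>\<^sup>+\<omega>. ennreal (?L \<omega>) \<partial>P) + ennreal (q ^ n) * \<dots>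
      \<le> ennreal (1 / q ^ n) * ennreal (r ^ n) + ennreal (q ^ n) * ennreal c"
    using K_mean(1) nn_integral_prod_L by (intro add_mono mult_left_mono) auto
  also have "\<dots> = ennreal (1 / q ^ n * r ^ n + q ^ n * c)"
    using q r K_mean(2) by (simp flip: ennreal_mult ennreal_plus)
  \<comment> \<open>Since \<open>r\<close> is at most the square of \<open>q\<close>, the first term
    is at most \<open>q ^ n\<close> as well.\<close>
  also have "\<dots> \<le> ennreal ((1 + c) * q ^ n)"
  proof (rule ennreal_leI)
    have "r ^ n \<le> (q\<^sup>2) ^ n" using q r by (intro power_mono)
    also have "\<dots> = q ^ n * q ^ n" by (simp add: power2_eq_square power_mult_distrib)
    finally have "1 / q ^ n * r ^ n \<le> q ^ n" using q by (simp add: field_simps)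
    then show "1 / q ^ n * r ^ n + q ^ n * c \<le> (1 + c) * q ^ n" by (simp add: algebra_simps)
  qed
  finally show ?thesis .
qed

section \<open>Exponential convergence in \<open>dist_BL\<close>\<close>

lemma dist_BL_push_le:
  assumes \<mu>: "\<mu> \<in> borel_prob1" and Y: "Y \<in> P \<rightarrow>\<^sub>M borel"
    and near: "(\<integral>\<^sup>+\<omega>. ennreal (min 1 (dist (comp_maps S \<omega> n x0) (Y \<omega>))) \<partial>P) \<le> ennreal e" "0 \<le> e"
  shows "dist_BL (push \<Theta> S \<mu> n) (distr P borel Y) \<le> 2 * (r ^ n * (\<integral>x. dist x x0 \<partial>\<mu>) + e)"
proof (rule dist_BL_least)
  fix f :: "'x \<Rightarrow> real" assume f: "f \<in> lip_unit"
  have \<mu>': "\<mu> \<in> borel_prob" using \<mu> by (simp add: borel_prob1_def)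
  then have [measurable_cong]: "sets \<mu> = sets borel" by (simp add: borel_prob_def)
  interpret \<mu>: prob_space \<mu> using \<mu>' by (simp add: borel_prob_def)
  interpret pair_prob_space \<mu> P ..
  define V where "V = (\<integral>x. dist x x0 \<partial>\<mu>)"
  have V0: "0 \<le> V" by (simp add: V_def)
  \<comment> \<open>The coupling consists of the image of the random start, the image of
    \<open>x0\<close> under the same maps, and \<open>Y\<close>. The first two are close by mean
    contraction, the last two by the hypothesis \<open>near\<close>.\<close>
  let ?X = "\<lambda>w. comp_maps S (snd w) n (fst w)" and ?B = "\<lambda>w. comp_maps S (snd w) n x0"
  have X[measurable]: "?X \<in> \<mu> \<Otimes>\<^sub>M P \<rightarrow>\<^sub>M borel" by (rule comp_maps_measurable') measurable
  have X0[measurable]: "?B \<in> \<mu> \<Otimes>\<^sub>M P \<rightarrow>\<^sub>M borel" by (rule comp_maps_measurable') measurable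
  have Z[measurable]: "(\<lambda>\<omega>. comp_maps S \<omega> n x0) \<in> P \<rightarrow>\<^sub>M borel" by (rule comp_maps_measurable') measurable
  note [measurable] = Y
  \<comment> \<open>Adjoining an independent start does not change the law of \<open>Y\<close>,
    because the second marginal of the product is \<open>P\<close>.\<close>
  have Y_law: "distr P borel Y = distr (\<mu> \<Otimes>\<^sub>M P) borel (\<lambda>w. Y (snd w))"
  proof -
    have "distr (\<mu> \<Otimes>\<^sub>M P) P snd = P"
    proof (rule measure_eqI)
      fix A assume "A \<in> sets (distr (\<mu> \<Otimes>\<^sub>M P) P snd)"
      then have A: "A \<in> sets P" by simp
      then have "snd -` A \<inter> space (\<mu> \<Otimes>\<^sub>M P) = space \<mu> \<times> A"
        by (auto simp: space_pair_measure dest: sets.sets_into_space)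
      with A show "emeasure (distr (\<mu> \<Otimes>\<^sub>M P) P snd) A = emeasure P A"
        by (simp add: emeasure_distr param.emeasure_pair_measure_Times \<mu>.emeasure_space_1)
    qed simp
    then have "distr P borel Y = distr (distr (\<mu> \<Otimes>\<^sub>M P) P snd) borel Y" by simp
    also have "\<dots> = distr (\<mu> \<Otimes>\<^sub>M P) borel (\<lambda>w. Y (snd w))"
      by (subst distr_distr) (auto simp: comp_def)
    finally show ?thesis .
  qed
  have fubini: "(\<integral>\<^sup>+w. g w \<partial>(\<mu> \<Otimes>\<^sub>M P)) = (\<integral>\<^sup>+x. \<integral>\<^sup>+\<omega>. g (x, \<omega>) \<partial>P \<partial>\<mu>)"
    if "g \<in> borel_measurable (\<mu> \<Otimes>\<^sub>M P)" for g :: "_ \<Rightarrow> ennreal"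
    by (rule param.nn_integral_fst[OF that, symmetric])
  have bound1: "(\<integral>\<^sup>+w. ennreal (dist (?X w) (?B w)) \<partial>(\<mu> \<Otimes>\<^sub>M P)) \<le> ennreal (r ^ n) * ennreal V"
  proof -
    have "(\<integral>\<^sup>+w. ennreal (dist (?X w) (?B w)) \<partial>(\<mu> \<Otimes>\<^sub>M P))
        = (\<integral>\<^sup>+x. \<integral>\<^sup>+\<omega>. ennreal (dist (comp_maps S \<omega> n x) (comp_maps S \<omega> n x0)) \<partial>P \<partial>\<mu>)"
      by (subst fubini) simp_all
    also have "\<dots> \<le> (\<integral>\<^sup>+x. ennreal (r ^ n) * ennreal (dist x x0) \<partial>\<mu>)"
      using nn_integral_dist_comp_maps r by (intro nn_integral_mono) (simp flip: ennreal_mult)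
    also have "\<dots> = ennreal (r ^ n) * ennreal V"
      by (simp add: nn_integral_cmult nn_integral_dist_eq_integral[OF \<mu>] V_def)
    finally show ?thesis .
  qed
  have bound2: "(\<integral>\<^sup>+w. ennreal (min 1 (dist (?B w) (Y (snd w)))) \<partial>(\<mu> \<Otimes>\<^sub>M P)) \<le> ennreal e"
    using near(1)
    by (subst fubini) (simp_all add: \<mu>.emeasure_space_1)
  have "(\<integral>\<^sup>+w. ennreal (min 1 (dist (?X w) (Y (snd w)))) \<partial>(\<mu> \<Otimes>\<^sub>M P))
      \<le> (\<integral>\<^sup>+w. ennreal (dist (?X w) (?B w)) + ennreal (min 1 (dist (?B w) (Y (snd w)))) \<partial>(\<mu> \<Otimes>\<^sub>M P))"
  proof (rule nn_integral_mono)
    fix w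
    \<comment> \<open>Only the second distance keeps its truncation: the first has a finite mean
      since \<open>\<mu>\<close> has a first moment, whereas \<open>Y\<close> is controlled in the
      truncated distance only.\<close>
    have "min 1 (dist (?X w) (Y (snd w))) \<le> dist (?X w) (?B w) + min 1 (dist (?B w) (Y (snd w)))"
      using dist_triangle[of "?X w" "Y (snd w)" "?B w"] zero_le_dist[of "?X w" "?B w"] by linarith
    then show "ennreal (min 1 (dist (?X w) (Y (snd w))))
        \<le> ennreal (dist (?X w) (?B w)) + ennreal (min 1 (dist (?B w) (Y (snd w))))"
      by (simp add: ennreal_leI flip: ennreal_plus)
  qed
  also have "\<dots> = (\<integral>\<^sup>+w. ennreal (dist (?X w) (?B w)) \<partial>(\<mu> \<Otimes>\<^sub>M P))
      + (\<integral>\<^sup>+w. ennreal (min 1 (dist (?B w) (Y (snd w)))) \<partial>(\<mu> \<Otimes>\<^sub>M P))"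
    by (rule nn_integral_add) measurable
  also have "\<dots> \<le> ennreal (r ^ n) * ennreal V + ennreal e"
    by (rule add_mono[OF bound1 bound2])
  also have "\<dots> = ennreal (r ^ n * V + e)"
    using r V0 near(2) by (simp flip: ennreal_mult ennreal_plus)
  finally have le: "(\<integral>\<^sup>+w. ennreal (min 1 (dist (?X w) (Y (snd w)))) \<partial>(\<mu> \<Otimes>\<^sub>M P)) \<le> ennreal (r ^ n * V + e)" .
  have "ennreal \<bar>(\<integral>x. f x \<partial>push \<Theta> S \<mu> n) - (\<integral>x. f x \<partial>distr P borel Y)\<bar>
      \<le> 2 * (\<integral>\<^sup>+w. ennreal (min 1 (dist (?X w) (Y (snd w)))) \<partial>(\<mu> \<Otimes>\<^sub>M P))"
    unfolding push_eq_distr[OF \<mu>'] Y_law case_prod_beta'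
    by (rule lip_unit_integral_diff_le[OF f X]) measurable
  also have "\<dots> \<le> 2 * ennreal (r ^ n * V + e)" by (rule mult_left_mono[OF le]) simp
  also have "\<dots> = ennreal (2 * (r ^ n * V + e))"
    using r V0 near(2) by (simp add: ennreal_mult)
  finally show "\<bar>(\<integral>x. f x \<partial>push \<Theta> S \<mu> n) - (\<integral>x. f x \<partial>distr P borel Y)\<bar> \<le> 2 * (r ^ n * (\<integral>x. dist x x0 \<partial>\<mu>) + e)"
    using r V0 near(2) by (subst (asm) ennreal_le_iff) (auto simp: V_def)
qed

text \<open>The increments are controlled only from index \<open>N\<close> on, so the almost sure
  limit is taken along the orbit shifted by \<open>N\<close>, and \<open>\<pi>\<close> is its law.
  Earlier indices are covered by the trivial bound 2 on \<open>dist_BL\<close>.\<close>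

lemma exists_exponential_limit:
  assumes incr: "\<And>n. n \<ge> N \<Longrightarrow>
      (\<integral>\<^sup>+\<omega>. ennreal (min 1 (dist (comp_maps S \<omega> n x0) (comp_maps S \<omega> (Suc n) x0))) \<partial>P) \<le> ennreal (A * q ^ n)"
    and A: "0 \<le> A" and q: "0 < q" "q < 1" "r \<le> q"
  obtains \<pi> C where "\<pi> \<in> borel_prob" "0 \<le> C"
    "\<And>\<mu> n. \<mu> \<in> borel_prob1 \<Longrightarrow> dist_BL (push \<Theta> S \<mu> n) \<pi> \<le> C * q ^ n * (1 + (\<integral>x. dist x x0 \<partial>\<mu>))"
proof -
  have "(\<lambda>\<omega>. comp_maps S \<omega> n x0) \<in> P \<rightarrow>\<^sub>M borel" for n
    by (rule comp_maps_measurable') measurable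
  moreover have "(\<integral>\<^sup>+\<omega>. ennreal (min 1 (dist (comp_maps S \<omega> (n + N) x0) (comp_maps S \<omega> (Suc n + N) x0))) \<partial>P)
      \<le> ennreal (A * q ^ N * q ^ n)" for n
    using incr[of "n + N"] by (simp add: power_add mult_ac)
  ultimately obtain Y where Y: "Y \<in> P \<rightarrow>\<^sub>M borel" and
    near: "\<And>n. (\<integral>\<^sup>+\<omega>. ennreal (min 1 (dist (comp_maps S \<omega> (n + N) x0) (Y \<omega>))) \<partial>P)
      \<le> ennreal (A * q ^ N / (1 - q) * q ^ n)"
    using q A by (elim param.limit_of_geometric_increments[of "\<lambda>n \<omega>. comp_maps S \<omega> (n + N) x0" "A * q ^ N" q, rotated 1]) auto
  define \<pi> where "\<pi> = distr P borel Y"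
  \<comment> \<open>The first summand serves the indices from \<open>N\<close> on. The second makes
    \<open>C * q ^ n\<close> at least 2 for smaller \<open>n\<close>, since there
    \<open>q ^ n \<ge> q ^ N\<close>.\<close>
  define C where "C = 2 * (1 + A / (1 - q)) + 2 / q ^ N"
  have \<pi>: "\<pi> \<in> borel_prob"
    using Y by (simp add: \<pi>_def borel_prob_def param.prob_space_distr)
  have D0: "0 \<le> A / (1 - q)" using A q by simp
  then have C0: "0 \<le> C" using q by (simp add: C_def)
  have "dist_BL (push \<Theta> S \<mu> n) \<pi> \<le> C * q ^ n * (1 + (\<integral>x. dist x x0 \<partial>\<mu>))" if \<mu>: "\<mu> \<in> borel_prob1" for \<mu> n
  proof -
    define V where "V = (\<integral>x. dist x x0 \<partial>\<mu>)"
    have V0: "0 \<le> V" by (simp add: V_def)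
    show ?thesis
    proof (cases "n \<ge> N")
      case True
      have "dist_BL (push \<Theta> S \<mu> n) \<pi> \<le> 2 * (r ^ n * V + A / (1 - q) * q ^ n)"
        unfolding \<pi>_def V_def
      proof (rule dist_BL_push_le[OF \<mu> Y])
        show "(\<integral>\<^sup>+\<omega>. ennreal (min 1 (dist (comp_maps S \<omega> n x0) (Y \<omega>))) \<partial>P) \<le> ennreal (A / (1 - q) * q ^ n)"
          using near[of "n - N"] True by (simp add: mult_ac flip: power_add)
        show "0 \<le> A / (1 - q) * q ^ n" using D0 q by (intro mult_nonneg_nonneg) auto
      qed
      also have "\<dots> \<le> 2 * (q ^ n * V + A / (1 - q) * q ^ n)"
        using V0 r q by (intro mult_left_mono add_mono mult_right_mono power_mono) auto
      also have "\<dots> = q ^ n * (2 * V + 2 * (A / (1 - q)))" by (simp add: algebra_simps)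
      also have "\<dots> \<le> q ^ n * (C * (1 + V))"
      proof (intro mult_left_mono)
        have "0 \<le> 2 / q ^ N" using q by simp
        moreover have "C = 2 + 2 * (A / (1 - q)) + 2 / q ^ N" unfolding C_def by algebra
        ultimately have "2 \<le> C" and C: "2 * (A / (1 - q)) \<le> C" using D0 by linarith+
        have "2 * V \<le> C * V" by (rule mult_right_mono[OF \<open>2 \<le> C\<close> V0])
        then show "2 * V + 2 * (A / (1 - q)) \<le> C * (1 + V)"
          using C unfolding distrib_left by linarith
      qed (use q in simp)
      finally show ?thesis by (simp add: V_def mult_ac)
    next
      case False
      have "dist_BL (push \<Theta> S \<mu> n) \<pi> \<le> 2"
      proof (rule dist_BL_least)
        fix f :: "'x \<Rightarrow> real" assume f: "f \<in> lip_unit"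
        have "push \<Theta> S \<mu> n \<in> borel_prob"
          using \<mu> by (intro push_in_borel_prob) (simp add: borel_prob1_def)
        then show "\<bar>(\<integral>x. f x \<partial>push \<Theta> S \<mu> n) - (\<integral>x. f x \<partial>\<pi>)\<bar> \<le> 2"
          using lip_unit_integral_abs_le[OF f, of "push \<Theta> S \<mu> n"] lip_unit_integral_abs_le[OF f \<pi>] by linarith
      qed
      also have "2 \<le> (2 / q ^ N) * q ^ n"
        using q False power_decreasing[of n N q] by (simp add: field_simps)
      also have "\<dots> \<le> C * q ^ n"
        using D0 q by (intro mult_right_mono) (auto simp: C_def)
      also have "\<dots> \<le> C * q ^ n * (1 + V)"
        using mult_left_mono[of 1 "1 + V" "C * q ^ n"] C0 V0 q by simp
      finally show ?thesis by (simp add: V_def)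
    qed
  qed
  then show ?thesis using that \<pi> C0 by blast
qed

end

section \<open>Reduction of the hypotheses to the locale and derivation of both claims\<close>

theorem proposition2p1:
  fixes \<Theta> :: "nat \<Rightarrow> 'p measure"
    and S :: "nat \<Rightarrow> 'p \<Rightarrow> 'x::polish_space \<Rightarrow> 'x"
    and L :: "nat \<Rightarrow> 'p \<Rightarrow> real"
    and x0 :: 'x
  assumes prob: "\<And>n. n \<ge> 1 \<Longrightarrow> prob_space (\<Theta> n)"
    and S_meas: "\<And>n. n \<ge> 1 \<Longrightarrow> (\<lambda>(x, \<theta>). S n \<theta> x) \<in> borel \<Otimes>\<^sub>M \<Theta> n \<rightarrow>\<^sub>M borel"
    and L_meas: "\<And>n. n \<ge> 1 \<Longrightarrow> L n \<in> \<Theta> n \<rightarrow>\<^sub>M restrict_space borel {0<..}"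
    and A1: "\<And>n. n \<ge> 1 \<Longrightarrow>
       AE \<theta> in \<Theta> n. \<forall>x y. dist (S n \<theta> x) (S n \<theta> y) \<le> L n \<theta> * dist x y"
    and A2_law: "\<And>E m n. E \<in> sets (restrict_space borel {0<..}) \<Longrightarrow> m \<ge> 1 \<Longrightarrow> n \<ge> 1 \<Longrightarrow>
       emeasure (\<Theta> m) (L m -` E \<inter> space (\<Theta> m)) = emeasure (\<Theta> n) (L n -` E \<inter> space (\<Theta> n))"
    and A2_mean: "(\<integral>\<^sup>+\<theta>. ennreal (L 1 \<theta>) \<partial>\<Theta> 1) < \<infinity>"
    and A2_log: "ext_integral (\<Theta> 1) (\<lambda>\<theta>. ln (L 1 \<theta>)) < 0"
    and R: "(\<integral>\<^sup>+\<theta>. ennreal (L 1 \<theta>) \<partial>\<Theta> 1) < 1"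
    and b: "(SUP n\<in>{1..}. \<integral>\<^sup>+\<theta>. ennreal (dist (S n \<theta> x0) x0) \<partial>\<Theta> n) < \<infinity>"
  shows "(\<forall>\<mu>\<in>borel_prob1. \<forall>\<pi>\<in>borel_prob.
            weakly_converges (push \<Theta> S \<mu>) \<pi> \<longrightarrow> \<pi> \<in> borel_prob1) \<and>
         (\<forall>n0\<ge>1. \<forall>K :: nat \<Rightarrow> (nat \<Rightarrow> 'p) \<Rightarrow> real.
            (\<forall>n\<ge>n0. K n \<in> PiM {1..n} \<Theta> \<rightarrow>\<^sub>M restrict_space borel {0..}) \<and>
            (\<forall>n\<ge>n0. AE \<omega> in PiM {1..n} \<Theta>.
               (\<forall>k\<in>{1..n}. bij (S k (\<omega> k))) \<and>
               dist x0 ((inv (comp_maps S \<omega> (n - 1)) \<circ> S n (\<omega> n) \<circ> comp_maps S \<omega> (n - 1)) x0)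
                 \<le> K n \<omega>) \<and>
            (SUP n\<in>{n0..}. iterated_integral \<Theta> n (\<lambda>\<omega>. ennreal (K n \<omega>))) < \<infinity> \<longrightarrow>
            (let is_limit = (\<lambda>\<pi>. \<pi> \<in> borel_prob \<and>
                   (\<exists>q\<in>{0<..<1}. \<exists>C\<ge>0. \<forall>\<mu>\<in>borel_prob1. \<forall>n\<ge>1.
                      dist_BL (push \<Theta> S \<mu> n) \<pi> \<le> C * q ^ n * (1 + (\<integral>x. dist x x0 \<partial>\<mu>))))
             in (\<exists>!\<pi>. is_limit \<pi>) \<and> (\<forall>\<pi>. is_limit \<pi> \<longrightarrow> \<pi> \<in> borel_prob1)))"
proof -
  \<comment> \<open>This is R as a real number; its finiteness ensures that \<open>enn2real\<close>
    does not return the default value 0.\<close>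
  define r where "r = enn2real (\<integral>\<^sup>+\<theta>. ennreal (L 1 \<theta>) \<partial>\<Theta> 1)"
  have r_eq: "ennreal r = (\<integral>\<^sup>+\<theta>. ennreal (L 1 \<theta>) \<partial>\<Theta> 1)" using A2_mean by (simp add: r_def)
  have "0 \<le> r" by (simp add: r_def)
  moreover from R have "ennreal r < ennreal 1" by (simp add: r_eq)
  ultimately have r: "0 \<le> r" "r < 1" by (simp_all add: ennreal_less_iff)
  have mean: "(\<integral>\<^sup>+\<theta>. ennreal (L n \<theta>) \<partial>\<Theta> n) = ennreal r" if n: "n \<ge> 1" for n
  proof -
    let ?B = "restrict_space borel {0<..} :: real measure"
    \<comment> \<open>The mean is the integral of the identity against the image law on the positive
      reals, hence determined by that law, which (A2) makes the same for every index.\<close>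
    have eq: "(\<integral>\<^sup>+\<theta>. ennreal (L m \<theta>) \<partial>\<Theta> m) = (\<integral>\<^sup>+t. ennreal t \<partial>distr (\<Theta> m) ?B (L m))" if "m \<ge> 1" for m
      by (subst nn_integral_distr[OF L_meas[OF that]]) (auto intro: measurable_restrict_space1)
    have "distr (\<Theta> n) ?B (L n) = distr (\<Theta> 1) ?B (L 1)"
      using A2_law[of _ n 1] n L_meas[of n] L_meas[of 1] by (intro measure_eqI) (auto simp: emeasure_distr)
    then show ?thesis using eq[OF n] eq[of 1] by (simp add: r_eq)
  qed
  interpret lipschitz_random_maps \<Theta> S L r
  proof (rule lipschitz_random_maps.intro)
    show "L n \<in> borel_measurable (\<Theta> n)" if "n \<ge> 1" for n
      using L_meas[OF that] by (simp add: measurable_restrict_space2_iff)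
    show "0 \<le> L n \<theta>" if "n \<ge> 1" "\<theta> \<in> space (\<Theta> n)" for n \<theta>
      using measurable_space[OF L_meas[OF that(1)] that(2)] by (simp add: space_restrict_space)
    show "(\<integral>\<^sup>+\<theta>. ennreal (L n \<theta>) \<partial>\<Theta> n) \<le> ennreal r" if "n \<ge> 1" for n
      using mean[OF that] by simp
    show "prob_space (\<Theta> n)" if "n \<ge> 1" for n by (rule prob[OF that])
    show "(\<lambda>(x, \<theta>). S n \<theta> x) \<in> borel \<Otimes>\<^sub>M \<Theta> n \<rightarrow>\<^sub>M borel" if "n \<ge> 1" for n
      by (rule S_meas[OF that])
    show "AE \<theta> in \<Theta> n. \<forall>x y. dist (S n \<theta> x) (S n \<theta> y) \<le> L n \<theta> * dist x y" if "n \<ge> 1" for n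
      by (rule A1[OF that])
    show "0 \<le> r" "r < 1" by fact+
  qed
  have finite_value: "\<exists>c\<ge>0. a = ennreal c" if "a < \<infinity>" for a
    using that by (intro exI[of _ "enn2real a"]) simp
  obtain B where B0: "0 \<le> B" and B: "(SUP n\<in>{1..}. \<integral>\<^sup>+\<theta>. ennreal (dist (S n \<theta> x0) x0) \<partial>\<Theta> n) = ennreal B"
    using finite_value[OF b] by blast
  have B_le: "(\<integral>\<^sup>+\<theta>. ennreal (dist (S n \<theta> x0) x0) \<partial>\<Theta> n) \<le> ennreal B" if "n \<ge> 1" for n
    unfolding B[symmetric] using that by (intro SUP_upper) auto
  \<comment> \<open>Stated for convergence against \<open>lip_unit\<close>, so that it applies to
    weak limits in the first claim and to \<open>dist_BL\<close> limits in the second.\<close>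
  have moment: "\<pi> \<in> borel_prob1"
    if \<mu>: "\<mu> \<in> borel_prob1" and \<pi>: "\<pi> \<in> borel_prob"
      and lim: "\<And>f. f \<in> lip_unit \<Longrightarrow> (\<lambda>n. \<integral>x. f x \<partial>push \<Theta> S \<mu> n) \<longlonglongrightarrow> (\<integral>x. f x \<partial>\<pi>)" for \<mu> \<pi>
  proof (rule finite_moment_of_lip_unit_limit[OF \<pi> _ _ lim])
    have \<mu>': "\<mu> \<in> borel_prob" using \<mu> by (simp add: borel_prob1_def)
    then show "push \<Theta> S \<mu> n \<in> borel_prob" for n by (rule push_in_borel_prob)
    show "(\<integral>\<^sup>+x. ennreal (dist x x0) \<partial>push \<Theta> S \<mu> n) \<le> ennreal ((\<integral>x. dist x x0 \<partial>\<mu>) + B / (1 - r))" for n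
      using nn_integral_dist_eq_integral[OF \<mu>, of x0] B_le B0 by (intro nn_integral_dist_push[OF \<mu>']) auto
  qed
  have part1: "\<pi> \<in> borel_prob1"
    if "\<mu> \<in> borel_prob1" "\<pi> \<in> borel_prob" "weakly_converges (push \<Theta> S \<mu>) \<pi>" for \<mu> \<pi>
  proof (rule moment[OF that(1,2)])
    fix f :: "'x \<Rightarrow> real" assume f: "f \<in> lip_unit"
    then have "continuous_on UNIV f" by (auto simp: lip_unit_def intro: lipschitz_on_continuous_on)
    moreover have "bounded (range f)"
      using lip_unit_abs_le[OF f] by (auto simp: bounded_iff)
    ultimately show "(\<lambda>n. \<integral>x. f x \<partial>push \<Theta> S \<mu> n) \<longlonglongrightarrow> (\<integral>x. f x \<partial>\<pi>)"
      using that(3) by (simp add: weakly_converges_def)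
  qed
  define is_limit where "is_limit = (\<lambda>\<pi>. \<pi> \<in> borel_prob \<and>
    (\<exists>q\<in>{0<..<1}. \<exists>C\<ge>0. \<forall>\<mu>\<in>borel_prob1. \<forall>n\<ge>1.
      dist_BL (push \<Theta> S \<mu> n) \<pi> \<le> C * q ^ n * (1 + (\<integral>x. dist x x0 \<partial>\<mu>))))"
  \<comment> \<open>The point mass at \<open>x0\<close> has finite first moment, so the exponential
    bound applies to it. One orbit of measures then yields both the uniqueness of the limit and its
    moment.\<close>
  let ?\<delta> = "return borel x0"
  have \<delta>: "?\<delta> \<in> borel_prob1" by (rule return_in_borel_prob1)
  have limit: "(\<lambda>n. \<integral>x. f x \<partial>push \<Theta> S ?\<delta> n) \<longlonglongrightarrow> (\<integral>x. f x \<partial>\<pi>)"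
    if \<pi>: "is_limit \<pi>" and f: "f \<in> lip_unit" for \<pi> and f :: "'x \<Rightarrow> real"
  proof -
    obtain q C where q: "0 < q" "q < 1" and
      le: "\<And>n. n \<ge> 1 \<Longrightarrow> dist_BL (push \<Theta> S ?\<delta> n) \<pi> \<le> C * q ^ n * (1 + (\<integral>x. dist x x0 \<partial>?\<delta>))"
      using \<pi> \<delta> unfolding is_limit_def by fastforce
    have "push \<Theta> S ?\<delta> n \<in> borel_prob" for n
      using \<delta> by (intro push_in_borel_prob) (simp add: borel_prob1_def)
    then have "\<bar>(\<integral>x. f x \<partial>push \<Theta> S ?\<delta> n) - (\<integral>x. f x \<partial>\<pi>)\<bar> \<le> dist_BL (push \<Theta> S ?\<delta> n) \<pi>" for n
      using \<pi> by (intro dist_BL_upper[OF f]) (auto simp: is_limit_def)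
    with le have "\<forall>\<^sub>F n in sequentially. norm ((\<integral>x. f x \<partial>push \<Theta> S ?\<delta> n) - (\<integral>x. f x \<partial>\<pi>))
        \<le> C * q ^ n * (1 + (\<integral>x. dist x x0 \<partial>?\<delta>))"
      unfolding eventually_sequentially real_norm_def by (meson order_trans)
    moreover have "(\<lambda>n. C * q ^ n * (1 + (\<integral>x. dist x x0 \<partial>?\<delta>))) \<longlonglongrightarrow> 0"
      using q by (intro tendsto_mult_left_zero tendsto_mult_right_zero LIMSEQ_realpow_zero) auto
    ultimately show ?thesis
      by (rule LIM_zero_cancel[OF Lim_null_comparison])
  qed
  have "(\<exists>!\<pi>. is_limit \<pi>) \<and> (\<forall>\<pi>. is_limit \<pi> \<longrightarrow> \<pi> \<in> borel_prob1)"
    if n0: "n0 \<ge> 1"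
      and K: "\<forall>n\<ge>n0. K n \<in> PiM {1..n} \<Theta> \<rightarrow>\<^sub>M restrict_space borel {0..}"
      and A3: "\<forall>n\<ge>n0. AE \<omega> in PiM {1..n} \<Theta>. (\<forall>k\<in>{1..n}. bij (S k (\<omega> k))) \<and>
        dist x0 ((inv (comp_maps S \<omega> (n - 1)) \<circ> S n (\<omega> n) \<circ> comp_maps S \<omega> (n - 1)) x0) \<le> K n \<omega>"
      and A4: "(SUP n\<in>{n0..}. iterated_integral \<Theta> n (\<lambda>\<omega>. ennreal (K n \<omega>))) < \<infinity>"
    for n0 and K :: "nat \<Rightarrow> (nat \<Rightarrow> 'p) \<Rightarrow> real"
  proof
    obtain c where c0: "0 \<le> c" and c: "(SUP n\<in>{n0..}. iterated_integral \<Theta> n (\<lambda>\<omega>. ennreal (K n \<omega>))) = ennreal c"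
      using finite_value[OF A4] by blast
    \<comment> \<open>The square root gives \<open>r\<close> at most the square of \<open>q\<close>,
      as the splitting of the increments requires; the value 1/2 keeps \<open>q\<close> positive
      from \<open>0 \<le> r\<close> alone.\<close>
    define q where "q = max (1 / 2) (sqrt r)"
    have q: "0 < q" "q < 1" using r by (auto simp: q_def)
    have rq2: "r \<le> q\<^sup>2"
      using r power_mono[of "sqrt r" q 2] by (simp add: q_def)
    have "q\<^sup>2 \<le> q" using q by (simp add: power2_eq_square mult_left_le)
    with rq2 have rq: "r \<le> q" by linarith
    \<comment> \<open>The step from \<open>n\<close> to \<open>Suc n\<close> uses (A3) and (A4) at
      index \<open>Suc n\<close>, which is at least \<open>n0\<close>.\<close>
    have incr: "(\<integral>\<^sup>+\<omega>. ennreal (min 1 (dist (comp_maps S \<omega> n x0) (comp_maps S \<omega> (Suc n) x0))) \<partial>P)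
        \<le> ennreal ((1 + c) * q ^ n)" if "n \<ge> n0" for n
    proof (rule nn_integral_increment[OF _ _ _ _ c0 q(1) rq2])
      have Kn: "K (Suc n) \<in> PiM {1..Suc n} \<Theta> \<rightarrow>\<^sub>M restrict_space borel {0..}" using K that by simp
      then show K_meas: "K (Suc n) \<in> borel_measurable (PiM {1..Suc n} \<Theta>)"
        by (simp add: measurable_restrict_space2_iff)
      show "0 \<le> K (Suc n) \<omega>" if "\<omega> \<in> space (PiM {1..Suc n} \<Theta>)" for \<omega>
        using measurable_space[OF Kn that] by (simp add: space_restrict_space)
      show "AE \<omega> in PiM {1..Suc n} \<Theta>. (\<forall>k\<in>{1..Suc n}. bij (S k (\<omega> k))) \<and>
          dist x0 ((inv (comp_maps S \<omega> n) \<circ> S (Suc n) (\<omega> (Suc n)) \<circ> comp_maps S \<omega> n) x0) \<le> K (Suc n) \<omega>"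
        using A3[rule_format, of "Suc n"] that by simp
      have "(\<integral>\<^sup>+\<omega>. ennreal (K (Suc n) \<omega>) \<partial>PiM {1..Suc n} \<Theta>) = iterated_integral \<Theta> (Suc n) (\<lambda>\<omega>. ennreal (K (Suc n) \<omega>))"
        using K_meas by (intro iterated_integral_eq_nn_integral[symmetric]) measurable
      also have "\<dots> \<le> ennreal c"
        unfolding c[symmetric] using that by (intro SUP_upper) auto
      finally show "(\<integral>\<^sup>+\<omega>. ennreal (K (Suc n) \<omega>) \<partial>PiM {1..Suc n} \<Theta>) \<le> ennreal c" .
    qed
    have "0 \<le> 1 + c" using c0 by simp
    then obtain \<pi> C where "\<pi> \<in> borel_prob" "0 \<le> C"
      "\<And>\<mu> n. \<mu> \<in> borel_prob1 \<Longrightarrow> dist_BL (push \<Theta> S \<mu> n) \<pi> \<le> C * q ^ n * (1 + (\<integral>x. dist x x0 \<partial>\<mu>))"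
      using exists_exponential_limit[OF incr _ q rq] by blast
    then have "is_limit \<pi>" using q unfolding is_limit_def by (auto intro!: bexI[of _ q] exI[of _ C])
    \<comment> \<open>The rates and constants of the two measures may differ, but both are limits of
      the same sequence of integrals for every test function.\<close>
    moreover have "\<pi>1 = \<pi>2" if "is_limit \<pi>1" "is_limit \<pi>2" for \<pi>1 \<pi>2
    proof (rule borel_prob_eqI_lip_unit)
      show "\<pi>1 \<in> borel_prob" "\<pi>2 \<in> borel_prob" using that by (simp_all add: is_limit_def)
      show "(\<integral>x. f x \<partial>\<pi>1) = (\<integral>x. f x \<partial>\<pi>2)" if "f \<in> lip_unit" for f
        using limit[OF \<open>is_limit \<pi>1\<close> that] limit[OF \<open>is_limit \<pi>2\<close> that] by (rule LIMSEQ_unique)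
    qed
    ultimately show "\<exists>!\<pi>. is_limit \<pi>" by blast
    show "\<forall>\<pi>. is_limit \<pi> \<longrightarrow> \<pi> \<in> borel_prob1"
      using moment[OF \<delta>] limit by (auto simp: is_limit_def)
  qed
  then show ?thesis
    unfolding Let_def is_limit_def[symmetric] using part1 by blast
qed

end
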